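(* Consider $CN$ active users grouped into $C$ clusters of $N\ge 2$ users each. The users evolve independently, each according to a two-state (TX/Idle) Markov process that moves from TX to Idle with probability $s$ and from Idle to TX with probability $r$ in each time slot, where $r,s\in[0,1]$. Let $\lambda:=\frac{r}{r+s}$ and $\theta:=1-r-s$. Let $m_a,v_a^2$ be the mean and temporal variance of the delivery process of an active user, and $m_p,v_p^2$ the mean and temporal variance of the passive detection process. Then $$m_a=\lambda(1-\lambda)^{N-1},\qquad m_p=(1-\lambda)^{CN},$$ $$v_a^2=2\sum_{k=1}^{\infty}\Big(\big(\lambda+(1-\lambda)\theta^{k}\big)\big(1-\lambda+\lambda\theta^{k}\big)^{N-1}-m_a\Big)m_a+m_a-m_a^2,$$ $$v_p^2=2\sum_{k=1}^{\infty}\Big(\big(1-\lambda+\lambda\theta^{k}\big)^{CN}-m_p\Big)m_p+m_p-m_p^2.$$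
   Context: Time is slotted, $t=1,2,\dots$. An active user transmits in slot $t$ if and only if it is in state TX in slot $t$. Active users in the same cluster interfere with each other but not with users of other clusters; a passive user never transmits and is interfered with by all active users. Delivery process of an active user $n$: $[S_n(1),S_n(2),\dots]$, where $S_n(t)$ is the indicator that $n$ successfully delivers a packet at time $t$, i.e. that $n$ is the only active user in its cluster that transmits at time $t$. By symmetry the delivery processes of all active users follow the same distribution. Passive detection process of a passive user $j$: $[S_j(1),S_j(2),\dots]$, where $S_j(t)$ is the indicator that no active user (in any cluster) transmits at time $t$. The means and temporal variances are defined by $$m_a:=\lim_{T\to\infty}\frac{\sum_{t=1}^{T}S_n(t)}{T},\qquad v_a^2:=E\Big[\Big(\lim_{T\to\infty}\frac{\sum_{t=1}^{T}S_n(t)-Tm_a}{\sqrt T}\Big)^2\Big],$$ $$m_p:=\lim_{T\to\infty}\frac{\sum_{t=1}^{T}S_j(t)}{T},\qquad v_p^2:=E\Big[\Big(\lim_{T\to\infty}\frac{\sum_{t=1}^{T}S_j(t)-Tm_p}{\sqrt T}\Big)^2\Big],$$ where the expectation is taken over all sample paths.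
   Formalization: The cases r=s=0 (λ undefined) and r=s=1 (deterministic alternation: the mean is 0 or 1/2, never 2^{-N}, and the series diverge) are excluded; the limit inside the temporal variance is taken in distribution, since it does not exist pathwise in general. *)

theory Defs
  imports "HOL-Probability.Probability"
begin

datatype mode = TX | Idle

fun trans_prob :: "real \<Rightarrow> real \<Rightarrow> mode \<Rightarrow> mode \<Rightarrow> real" where
  "trans_prob r s TX Idle = s"
| "trans_prob r s TX TX = 1 - s"
| "trans_prob r s Idle TX = r"
| "trans_prob r s Idle Idle = 1 - r"

text \<open>Time slots are 1, 2, ...; the state in slot 0 plays no role. The distribution of the
  state in the first slot is arbitrary.\<close>

definition two_state_markov ::
    "'a measure \<Rightarrow> real \<Rightarrow> real \<Rightarrow> (nat \<Rightarrow> 'a \<Rightarrow> mode) \<Rightarrow> bool" where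
  "two_state_markov M r s Z \<longleftrightarrow>
     (\<forall>t\<ge>1. Z t \<in> measurable M (count_space UNIV)) \<and>
     (\<forall>t\<ge>1. \<forall>z y. \<P>(\<omega> in M. \<forall>i\<in>{1..t}. Z i \<omega> = z i) > 0 \<longrightarrow>
        \<P>(\<omega> in M. Z (Suc t) \<omega> = y \<bar> \<forall>i\<in>{1..t}. Z i \<omega> = z i) = trans_prob r s (z t) y)"

text \<open>User \<open>(c, i)\<close> is the \<open>i\<close>-th user of cluster \<open>c\<close>.\<close>

definition users :: "nat \<Rightarrow> nat \<Rightarrow> (nat \<times> nat) set" where
  "users C N = {..<C} \<times> {..<N}"

text \<open>Independence is between the users' whole trajectories over the slots 1, 2, ...\<close>

definition independent_two_state_users ::
    "'a measure \<Rightarrow> nat \<Rightarrow> nat \<Rightarrow> real \<Rightarrow> real \<Rightarrow> (nat \<times> nat \<Rightarrow> nat \<Rightarrow> 'a \<Rightarrow> mode) \<Rightarrow> bool" where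
  "independent_two_state_users M C N r s X \<longleftrightarrow>
     (\<forall>u\<in>users C N. two_state_markov M r s (X u)) \<and>
     prob_space.indep_vars M (\<lambda>_. \<Pi>\<^sub>M t\<in>{1..}. count_space UNIV)
       (\<lambda>u \<omega>. \<lambda>t\<in>{1..}. X u t \<omega>) (users C N)"

definition delivery ::
    "nat \<Rightarrow> (nat \<times> nat \<Rightarrow> nat \<Rightarrow> 'a \<Rightarrow> mode) \<Rightarrow> nat \<times> nat \<Rightarrow> nat \<Rightarrow> 'a \<Rightarrow> real" where
  "delivery N X = (\<lambda>(c, i) t \<omega>.
     of_bool (X (c, i) t \<omega> = TX \<and> (\<forall>j<N. j \<noteq> i \<longrightarrow> X (c, j) t \<omega> \<noteq> TX)))"

definition passive_detection ::
    "nat \<Rightarrow> nat \<Rightarrow> (nat \<times> nat \<Rightarrow> nat \<Rightarrow> 'a \<Rightarrow> mode) \<Rightarrow> nat \<Rightarrow> 'a \<Rightarrow> real" where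
  "passive_detection C N X t \<omega> = of_bool (\<forall>u\<in>users C N. X u t \<omega> \<noteq> TX)"

definition has_temporal_mean :: "'a measure \<Rightarrow> (nat \<Rightarrow> 'a \<Rightarrow> real) \<Rightarrow> real \<Rightarrow> bool" where
  "has_temporal_mean M S m \<longleftrightarrow>
     (AE \<omega> in M. (\<lambda>T. (\<Sum>t = 1..T. S t \<omega>) / real T) \<longlonglongrightarrow> m)"

text \<open>The centred sums scaled by \<open>1 / sqrt T\<close> have in general no almost sure limit (law of the
  iterated logarithm), so the limit inside the expectation is a limit in distribution. Here
  \<open>L\<close> is the law of that limit and \<open>v\<close> is its second moment.\<close>

definition has_temporal_variance ::
    "'a measure \<Rightarrow> (nat \<Rightarrow> 'a \<Rightarrow> real) \<Rightarrow> real \<Rightarrow> real \<Rightarrow> bool" where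
  "has_temporal_variance M S m v \<longleftrightarrow>
     (\<exists>L. real_distribution L \<and>
        weak_conv_m
          (\<lambda>T. distr M borel (\<lambda>\<omega>. ((\<Sum>t = 1..T. S t \<omega>) - real T * m) / sqrt (real T))) L \<and>
        integrable L (\<lambda>x. x\<^sup>2) \<and> (LINT x|L. x\<^sup>2) = v)"

end

theory Submission
  imports Defs "HOL-Real_Asymp.Real_Asymp"
begin

text \<open>
  The joint states of finitely many independent users form a finite Markov chain whose \<open>k\<close>-step
  transition probabilities are products of the two-state ones
  \<open>\<pi> y + \<theta>\<^sup>k (\<delta>\<^bsub>xy\<^esub> - \<pi> y)\<close>. These converge geometrically because \<open>\<bar>\<theta>\<bar> < 1\<close>, so that Poisson's equation
  \<open>g - P g = f\<close> is solved by \<open>g = (\<Sum>k. P\<^sup>k f)\<close> for every centred \<open>f\<close>. Hence sums of \<open>f\<close> along the chain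
  are martingales up to a bounded error, and a fourth moment bound yields the almost sure mean. For
  the limit in distribution, let \<open>S\<^sub>t\<close> be the sum of \<open>f\<close> over the first \<open>t\<close> states; second-order
  correctors \<open>a, b\<close>, again solutions of Poisson equations, make
  \<open>A\<^sub>t = E (exp (i \<xi> S\<^sub>t) (1 + i \<xi> a (Y\<^sub>t) + \<xi>\<^sup>2 b (Y\<^sub>t)))\<close> satisfy
  \<open>A\<^bsub>t+1\<^esub> = (1 - \<xi>\<^sup>2 v / 2) A\<^sub>t + O(\<xi>\<^sup>3)\<close>; with \<open>\<xi> = u / sqrt T\<close> this gives the limit \<open>exp (- u\<^sup>2 v / 2)\<close>,
  and Levy's continuity theorem applies. Both delivery and passive detection are indicators of a
  single joint state, for which \<open>v\<close> is the series of \<open>k\<close>-step return probabilities in the theorem.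
\<close>

subsection \<open>Finite Markov chains and Poisson's equation\<close>

text \<open>On \<open>space M\<close> the composition is a finite sum of indicators of the level
  sets of \<open>W\<close> scaled by values of \<open>F\<close>. Values in a Banach space are
  allowed because both real moments and complex exponentials are averaged later.\<close>

lemma (in prob_space) integral_finite_valued:
  fixes F :: "'c \<Rightarrow> 'b :: {banach, second_countable_topology}"
  assumes "finite A" and "\<And>\<omega>. \<omega> \<in> space M \<Longrightarrow> W \<omega> \<in> A"
    and ev: "\<And>w. w \<in> A \<Longrightarrow> {\<omega> \<in> space M. W \<omega> = w} \<in> events"
  shows "integrable M (\<lambda>\<omega>. F (W \<omega>))"
    and "expectation (\<lambda>\<omega>. F (W \<omega>)) = (\<Sum>w\<in>A. prob {\<omega> \<in> space M. W \<omega> = w} *\<^sub>R F w)"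
proof -
  let ?I = "\<lambda>w \<omega>. indicator {\<omega> \<in> space M. W \<omega> = w} \<omega> *\<^sub>R F w"
  have eq: "F (W \<omega>) = (\<Sum>w\<in>A. ?I w \<omega>)" if "\<omega> \<in> space M" for \<omega>
  proof -
    have "(\<Sum>w\<in>A. ?I w \<omega>) = (\<Sum>w\<in>A. if w = W \<omega> then F w else 0)"
      using that by (intro sum.cong) (auto simp: indicator_def)
    then show ?thesis
      using assms(1) assms(2)[OF that] by simp
  qed
  have "integrable M (?I w)" if "w \<in> A" for w
    using ev[OF that] by (intro integrable_scaleR_left integrable_real_indicator) (auto simp: emeasure_eq_measure)
  then have int: "integrable M (\<lambda>\<omega>. \<Sum>w\<in>A. ?I w \<omega>)"
    by (intro Bochner_Integration.integrable_sum)
  show "integrable M (\<lambda>\<omega>. F (W \<omega>))"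
    using int by (rule iffD2[OF Bochner_Integration.integrable_cong, OF refl, rotated]) (simp add: eq)
  have "expectation (\<lambda>\<omega>. F (W \<omega>)) = expectation (\<lambda>\<omega>. \<Sum>w\<in>A. ?I w \<omega>)"
    by (intro Bochner_Integration.integral_cong refl eq)
  also have "\<dots> = (\<Sum>w\<in>A. expectation (?I w))"
    using \<open>\<And>w. w \<in> A \<Longrightarrow> integrable M (?I w)\<close> by (rule Bochner_Integration.integral_sum)
  also have "\<dots> = (\<Sum>w\<in>A. prob {\<omega> \<in> space M. W \<omega> = w} *\<^sub>R F w)"
    using ev by (intro sum.cong refl) (simp add: Int_absorb1 emeasure_eq_measure)
  finally show "expectation (\<lambda>\<omega>. F (W \<omega>)) = (\<Sum>w\<in>A. prob {\<omega> \<in> space M. W \<omega> = w} *\<^sub>R F w)" .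
qed

text \<open>The transition operator acting on functions, so that its \<open>k\<close>-th power
  applied to the indicator of a state gives \<open>k\<close>-step transition probabilities.\<close>

definition kernel_step :: "'s set \<Rightarrow> ('s \<Rightarrow> 's \<Rightarrow> real) \<Rightarrow> ('s \<Rightarrow> real) \<Rightarrow> 's \<Rightarrow> real" where
  "kernel_step \<Omega> P g x = (\<Sum>y\<in>\<Omega>. P x y * g y)"

text \<open>The Markov property is phrased through path probabilities, which avoids conditioning on
  null events and leaves the law of \<open>Y 1\<close> arbitrary. Ergodicity is required only for
  indicators of states; linearity extends it to all functions.\<close>

locale finite_markov_chain = prob_space M for M :: "'a measure" +
  fixes Y :: "nat \<Rightarrow> 'a \<Rightarrow> 's" and \<Omega> :: "'s set"
    and P :: "'s \<Rightarrow> 's \<Rightarrow> real" and \<mu> :: "'s \<Rightarrow> real"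
  assumes finite_states: "finite \<Omega>"
    and Y_measurable: "\<And>t. t \<ge> 1 \<Longrightarrow> Y t \<in> measurable M (count_space \<Omega>)"
    and P_nonneg: "\<And>x y. x \<in> \<Omega> \<Longrightarrow> y \<in> \<Omega> \<Longrightarrow> P x y \<ge> 0"
    and P_sum: "\<And>x. x \<in> \<Omega> \<Longrightarrow> (\<Sum>y\<in>\<Omega>. P x y) = 1"
    and path_prob_Suc: "\<And>t y. t \<ge> 1 \<Longrightarrow> (\<And>i. i \<in> {1..Suc t} \<Longrightarrow> y i \<in> \<Omega>) \<Longrightarrow>
        prob {\<omega> \<in> space M. \<forall>i\<in>{1..Suc t}. Y i \<omega> = y i} =
        prob {\<omega> \<in> space M. \<forall>i\<in>{1..t}. Y i \<omega> = y i} * P (y t) (y (Suc t))"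
    and \<mu>_sum: "(\<Sum>x\<in>\<Omega>. \<mu> x) = 1"
    and \<mu>_stationary: "\<And>y. y \<in> \<Omega> \<Longrightarrow> (\<Sum>x\<in>\<Omega>. \<mu> x * P x y) = \<mu> y"
    and geometrically_ergodic:
      "\<exists>B c. 0 \<le> c \<and> c < 1 \<and> (\<forall>k. \<forall>x\<in>\<Omega>. \<forall>y\<in>\<Omega>.
         \<bar>(kernel_step \<Omega> P ^^ k) (\<lambda>x. of_bool (x = y)) x - \<mu> y\<bar> \<le> B * c ^ k)"
begin

abbreviation step :: "('s \<Rightarrow> real) \<Rightarrow> 's \<Rightarrow> real" where
  "step \<equiv> kernel_step \<Omega> P"

definition mean :: "('s \<Rightarrow> real) \<Rightarrow> real" where
  "mean g = (\<Sum>x\<in>\<Omega>. \<mu> x * g x)"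

text \<open>Restricting to \<open>{1..t}\<close> makes the whole past one random variable with
  values in the finite set \<open>PiE {1..t} (\<lambda>_. \<Omega>)\<close>.\<close>

definition history :: "nat \<Rightarrow> 'a \<Rightarrow> nat \<Rightarrow> 's" where
  "history t \<omega> = (\<lambda>i\<in>{1..t}. Y i \<omega>)"

lemma Y_in: "t \<ge> 1 \<Longrightarrow> \<omega> \<in> space M \<Longrightarrow> Y t \<omega> \<in> \<Omega>"
  using measurable_space[OF Y_measurable] by simp

lemma Y_event: 
  assumes "t \<ge> 1"
  shows "{\<omega> \<in> space M. Y t \<omega> = y} \<in> events"
proof -
  have "Y t -` ({y} \<inter> \<Omega>) \<inter> space M \<in> events"
    using Y_measurable[OF assms] by (rule measurable_sets) simp
  also have "Y t -` ({y} \<inter> \<Omega>) \<inter> space M = {\<omega> \<in> space M. Y t \<omega> = y}"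
    using Y_in[OF assms] by auto
  finally show ?thesis .
qed

lemma history_event: "{\<omega> \<in> space M. \<forall>i\<in>{1..t}. Y i \<omega> = y i} \<in> events"
  by (intro sets.sets_Collect_finite_All Y_event) auto

lemma history_in: "\<omega> \<in> space M \<Longrightarrow> history t \<omega> \<in> PiE {1..t} (\<lambda>_. \<Omega>)"
  by (auto simp: history_def intro: Y_in)

lemma history_eq_iff: "w \<in> PiE {1..t} (\<lambda>_. \<Omega>) \<Longrightarrow> history t \<omega> = w \<longleftrightarrow> (\<forall>i\<in>{1..t}. Y i \<omega> = w i)"
  by (auto simp: history_def fun_eq_iff restrict_def PiE_def extensional_def)

lemma finite_histories: "finite (PiE {1..t::nat} (\<lambda>_. \<Omega>))"
  using finite_states by (intro finite_PiE) auto

lemma integrable_history: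
  fixes F :: "(nat \<Rightarrow> 's) \<Rightarrow> 'b :: {banach, second_countable_topology}"
  shows "integrable M (\<lambda>\<omega>. F (history t \<omega>))"
proof (rule integral_finite_valued(1)[OF finite_histories])
  show "{\<omega> \<in> space M. history t \<omega> = w} \<in> events" if "w \<in> PiE {1..t} (\<lambda>_. \<Omega>)" for w
    using history_event[of t w] by (simp add: history_eq_iff[OF that])
qed (rule history_in)

text \<open>By \<open>path_prob_Suc\<close> the joint law of past and next state is the law of the
  past times a row of \<open>P\<close>, so the next state can be averaged out inside the
  expectation. This plays the part of conditional expectation throughout.\<close>

lemma expectation_step:
  fixes F :: "(nat \<Rightarrow> 's) \<Rightarrow> 's \<Rightarrow> 'b :: {banach, second_countable_topology}"
  assumes "t \<ge> 1"
  shows "expectation (\<lambda>\<omega>. F (history t \<omega>) (Y (Suc t) \<omega>)) =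
    expectation (\<lambda>\<omega>. \<Sum>y\<in>\<Omega>. P (Y t \<omega>) y *\<^sub>R F (history t \<omega>) y)"
proof -
  let ?A = "PiE {1..t} (\<lambda>_. \<Omega>)"
  \<comment> \<open>A past together with a next state is the same thing as a path of length
    \<open>Suc t\<close>, to which \<open>path_prob_Suc\<close> applies.\<close>
  have E: "{\<omega> \<in> space M. (history t \<omega>, Y (Suc t) \<omega>) = (w, y)} =
      {\<omega> \<in> space M. \<forall>i\<in>{1..Suc t}. Y i \<omega> = (w(Suc t := y)) i}" if "w \<in> ?A" for w y
    using history_eq_iff[OF that] by (auto simp: atLeastAtMostSuc_conv)
  have pr: "prob {\<omega> \<in> space M. (history t \<omega>, Y (Suc t) \<omega>) = (w, y)} =
      prob {\<omega> \<in> space M. history t \<omega> = w} * P (w t) y" if "w \<in> ?A" "y \<in> \<Omega>" for w y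
  proof -
    have "prob {\<omega> \<in> space M. \<forall>i\<in>{1..Suc t}. Y i \<omega> = (w(Suc t := y)) i} =
      prob {\<omega> \<in> space M. \<forall>i\<in>{1..t}. Y i \<omega> = (w(Suc t := y)) i} * P ((w(Suc t := y)) t) ((w(Suc t := y)) (Suc t))"
      using that assms by (intro path_prob_Suc) (auto simp: PiE_def Pi_def)
    moreover have "(\<forall>i\<in>{1..t}. Y i \<omega> = (w(Suc t := y)) i) \<longleftrightarrow> history t \<omega> = w" for \<omega>
      by (simp add: history_eq_iff[OF that(1)])
    ultimately show ?thesis
      unfolding E[OF that(1)] by simp
  qed
  have "expectation (\<lambda>\<omega>. case (history t \<omega>, Y (Suc t) \<omega>) of (w, y) \<Rightarrow> F w y) =
      (\<Sum>p\<in>?A \<times> \<Omega>. prob {\<omega> \<in> space M. (history t \<omega>, Y (Suc t) \<omega>) = p} *\<^sub>R (case p of (w, y) \<Rightarrow> F w y))"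
  proof (rule integral_finite_valued(2))
    show "finite (?A \<times> \<Omega>)"
      using finite_histories finite_states by (rule finite_cartesian_product)
    show "(history t \<omega>, Y (Suc t) \<omega>) \<in> ?A \<times> \<Omega>" if "\<omega> \<in> space M" for \<omega>
      using history_in[OF that] Y_in[OF _ that] by simp
    show "{\<omega> \<in> space M. (history t \<omega>, Y (Suc t) \<omega>) = p} \<in> events" if "p \<in> ?A \<times> \<Omega>" for p
      using that history_event by (cases p) (simp only: E mem_Sigma_iff)
  qed
  also have "\<dots> = (\<Sum>w\<in>?A. \<Sum>y\<in>\<Omega>. (prob {\<omega> \<in> space M. history t \<omega> = w} * P (w t) y) *\<^sub>R F w y)"
    unfolding sum.cartesian_product by (rule sum.cong) (auto simp: pr[simplified])
  also have "\<dots> = (\<Sum>w\<in>?A. prob {\<omega> \<in> space M. history t \<omega> = w} *\<^sub>R (\<Sum>y\<in>\<Omega>. P (w t) y *\<^sub>R F w y))"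
    by (simp add: scaleR_sum_right)
  also have "\<dots> = expectation (\<lambda>\<omega>. (\<lambda>w. \<Sum>y\<in>\<Omega>. P (w t) y *\<^sub>R F w y) (history t \<omega>))"
  proof (rule integral_finite_valued(2)[OF finite_histories, symmetric])
    show "{\<omega> \<in> space M. history t \<omega> = w} \<in> events" if "w \<in> PiE {1..t} (\<lambda>_. \<Omega>)" for w
      using history_event[of t w] by (simp add: history_eq_iff[OF that])
  qed (rule history_in)
  finally show ?thesis
    using assms by (simp add: history_def)
qed

section \<open>Powers of the transition operator and Poisson's equation\<close>

lemma step_sum: "step (\<lambda>x. \<Sum>i\<in>I. g i x) = (\<lambda>x. \<Sum>i\<in>I. step (g i) x)"
  by (simp add: kernel_step_def fun_eq_iff sum_distrib_left sum.swap[of _ I])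

lemma step_mult: "step (\<lambda>x. a * g x) = (\<lambda>x. a * step g x)"
  by (simp add: kernel_step_def fun_eq_iff sum_distrib_left mult.left_commute)

lemma step_cong: "(\<And>x. x \<in> \<Omega> \<Longrightarrow> g x = h x) \<Longrightarrow> step g = step h"
  by (simp add: kernel_step_def fun_eq_iff)

lemma step_pow_cong:
  "(\<And>x. x \<in> \<Omega> \<Longrightarrow> g x = h x) \<Longrightarrow> x \<in> \<Omega> \<Longrightarrow> (step ^^ k) g x = (step ^^ k) h x"
  by (cases k) (simp_all only: funpow_Suc_right funpow_0 o_def step_cong[of g h])

text \<open>On the state space \<open>g\<close> is a linear combination of indicators of single
  states, and powers of \<open>step\<close> are linear.\<close>

lemma step_pow_expand:
  assumes "x \<in> \<Omega>"
  shows "(step ^^ k) g x = (\<Sum>y\<in>\<Omega>. g y * (step ^^ k) (\<lambda>x. of_bool (x = y)) x)"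
proof -
  have "(step ^^ k) (\<lambda>x. \<Sum>y\<in>\<Omega>. g y * of_bool (x = y)) = (\<lambda>x. \<Sum>y\<in>\<Omega>. g y * (step ^^ k) (\<lambda>x. of_bool (x = y)) x)"
    by (induction k) (simp_all add: step_sum step_mult)
  moreover have "(\<Sum>y\<in>\<Omega>. g y * of_bool (x = y)) = g x" if "x \<in> \<Omega>" for x
    using finite_states that by (simp add: of_bool_def if_distrib cong: if_cong)
  ultimately show ?thesis
    using step_pow_cong[OF _ assms, of g "\<lambda>x. \<Sum>y\<in>\<Omega>. g y * of_bool (x = y)" k] by simp
qed

text \<open>The rate \<open>c\<close> for indicators carries over to every \<open>g\<close>;
  expanding \<open>g\<close> over the states only multiplies the constant by the sum of the values
  \<open>\<bar>g y\<bar>\<close>.\<close>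

lemma step_pow_tendsto_mean:
  "\<exists>B c. 0 \<le> c \<and> c < 1 \<and> (\<forall>k. \<forall>x\<in>\<Omega>. \<bar>(step ^^ k) g x - mean g\<bar> \<le> B * c ^ k)"
proof -
  from geometrically_ergodic obtain B c where c: "0 \<le> c" "c < 1"
    and B: "\<And>k x y. x \<in> \<Omega> \<Longrightarrow> y \<in> \<Omega> \<Longrightarrow> \<bar>(step ^^ k) (\<lambda>x. of_bool (x = y)) x - \<mu> y\<bar> \<le> B * c ^ k"
    by metis
  show ?thesis
  proof (intro exI conjI allI ballI)
    fix k x assume x: "x \<in> \<Omega>"
    have "(step ^^ k) g x - mean g = (\<Sum>y\<in>\<Omega>. g y * ((step ^^ k) (\<lambda>x. of_bool (x = y)) x - \<mu> y))"
      unfolding step_pow_expand[OF x, of k g] mean_def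
      by (simp add: algebra_simps sum_subtractf)
    also have "\<bar>\<dots>\<bar> \<le> (\<Sum>y\<in>\<Omega>. \<bar>g y\<bar> * (B * c ^ k))"
      using B[OF x] by (intro order.trans[OF sum_abs] sum_mono) (simp add: abs_mult mult_left_mono)
    finally show "\<bar>(step ^^ k) g x - mean g\<bar> \<le> (\<Sum>y\<in>\<Omega>. \<bar>g y\<bar> * B) * c ^ k"
      by (simp add: sum_distrib_right mult.assoc)
  qed (fact c)+
qed

text \<open>The deviation matrix of the chain applied to \<open>g\<close>. Subtracting the mean is
  what makes the series converge.\<close>

definition poisson :: "('s \<Rightarrow> real) \<Rightarrow> 's \<Rightarrow> real" where
  "poisson g x = (\<Sum>k. (step ^^ k) g x - mean g)"

lemma summable_step_pow:
  assumes "x \<in> \<Omega>"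
  shows "summable (\<lambda>k. (step ^^ k) g x - mean g)"
proof -
  obtain B c where c: "0 \<le> c" "c < 1"
    and B: "\<And>k x. x \<in> \<Omega> \<Longrightarrow> \<bar>(step ^^ k) g x - mean g\<bar> \<le> B * c ^ k"
    using step_pow_tendsto_mean[of g] by metis
  show ?thesis
  proof (rule summable_comparison_test')
    show "summable (\<lambda>k. B * c ^ k)"
      using c by (intro summable_mult summable_geometric) simp
    show "norm ((step ^^ k) g x - mean g) \<le> B * c ^ k" if "k \<ge> 0" for k
      using B[OF assms] by simp
  qed
qed

text \<open>A finite sum may be exchanged with the series, and rows of \<open>P\<close> sum to 1, so
  \<open>step\<close> merely shifts the index by one.\<close>

lemma step_poisson_sums:
  assumes "x \<in> \<Omega>"
  shows "(\<lambda>k. (step ^^ Suc k) g x - mean g) sums step (poisson g) x"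
proof -
  have "(\<lambda>k. \<Sum>y\<in>\<Omega>. P x y * ((step ^^ k) g y - mean g)) sums (\<Sum>y\<in>\<Omega>. P x y * poisson g y)"
    unfolding poisson_def by (intro sums_sum sums_mult summable_sums summable_step_pow)
  moreover have "(\<Sum>y\<in>\<Omega>. P x y * ((step ^^ k) g y - mean g)) = (step ^^ Suc k) g x - mean g" for k
    using P_sum[OF assms]
    by (simp add: right_diff_distrib sum_subtractf sum_distrib_right[symmetric] kernel_step_def[of _ _ "(step ^^ k) g"])
  ultimately show ?thesis
    by (simp add: kernel_step_def[of _ _ "poisson g"])
qed

text \<open>The series for \<open>poisson g\<close> and for its image under \<open>step\<close>
  differ exactly in the term \<open>k = 0\<close>.\<close>

lemma poisson_equation: "x \<in> \<Omega> \<Longrightarrow> poisson g x - step (poisson g) x = g x - mean g"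
  using suminf_split_head[OF summable_step_pow[of x g]] sums_unique[OF step_poisson_sums[of x g]]
  by (simp add: poisson_def[of g x])

end

subsection \<open>Convergence of characteristic functions\<close>

lemma iexp_quadratic_approx:
  fixes \<theta> :: real
  shows "cmod (iexp \<theta> - (1 + \<i> * \<theta> - \<theta>\<^sup>2 / 2)) \<le> \<bar>\<theta>\<bar> ^ 3 / 6"
proof -
  have "{..2::nat} = {0, 1, 2}" by auto
  then have "(\<Sum>k\<le>2. (\<i> * complex_of_real \<theta>) ^ k / fact k) = 1 + \<i> * \<theta> - \<theta>\<^sup>2 / 2"
    by (simp add: power_mult_distrib)
  then show ?thesis
    using iexp_approx1[of \<theta> 2] by (simp add: fact_numeral del: of_real_power)
qed

text \<open>Both factors are expanded to second order and multiplied; what remains has order at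
  least 3 in \<open>\<xi>\<close>, and \<open>\<bar>\<xi>\<bar> \<le> 1\<close> bounds the higher
  powers by the third.\<close>

lemma iexp_mult_expansion:
  fixes \<xi> f a b B :: real
  assumes B: "1 \<le> B" "\<bar>f\<bar> \<le> B" "\<bar>a\<bar> \<le> B" "\<bar>b\<bar> \<le> B" and \<xi>: "\<bar>\<xi>\<bar> \<le> 1"
  shows "cmod (iexp (\<xi> * f) * (1 + \<i> * \<xi> * a + \<xi>\<^sup>2 * b) -
    (1 + \<i> * \<xi> * (f + a) + \<xi>\<^sup>2 * (b - f * a - f\<^sup>2 / 2))) \<le> 3 * B ^ 4 * \<bar>\<xi>\<bar> ^ 3"
proof -
  define e where "e = iexp (\<xi> * f) - (1 + \<i> * \<xi> * f - \<xi>\<^sup>2 * f\<^sup>2 / 2)"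
  have "cmod e \<le> \<bar>\<xi> * f\<bar> ^ 3 / 6"
    using iexp_quadratic_approx[of "\<xi> * f"] by (simp add: e_def power_mult_distrib mult.assoc)
  also have "\<dots> \<le> \<bar>\<xi>\<bar> ^ 3 * B ^ 3 / 6"
    using B by (auto simp: abs_mult power_mult_distrib intro!: mult_left_mono power_mono)
  finally have e: "cmod e \<le> \<bar>\<xi>\<bar> ^ 3 * B ^ 3 / 6" .
  have \<xi>2: "\<xi>\<^sup>2 \<le> \<bar>\<xi>\<bar>" "\<xi>\<^sup>2 \<le> 1" "\<xi>\<^sup>2 * \<xi>\<^sup>2 \<le> \<bar>\<xi>\<bar> ^ 3"
  proof -
    show "\<xi>\<^sup>2 \<le> \<bar>\<xi>\<bar>"
      using mult_left_mono[OF \<xi>, of "\<bar>\<xi>\<bar>"] by (simp add: power2_eq_square)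
    then show "\<xi>\<^sup>2 \<le> 1" using \<xi> by simp
    have "\<xi>\<^sup>2 * \<xi>\<^sup>2 \<le> \<xi>\<^sup>2 * \<bar>\<xi>\<bar>"
      using \<open>\<xi>\<^sup>2 \<le> \<bar>\<xi>\<bar>\<close> by (intro mult_left_mono) auto
    also have "\<dots> = \<bar>\<xi>\<bar> ^ 3" by (simp add: power3_eq_cube power2_eq_square)
    finally show "\<xi>\<^sup>2 * \<xi>\<^sup>2 \<le> \<bar>\<xi>\<bar> ^ 3" .
  qed
  have w: "cmod (1 + \<i> * \<xi> * a + \<xi>\<^sup>2 * b) \<le> 3 * B"
  proof -
    have "cmod (1 + \<i> * \<xi> * a + \<xi>\<^sup>2 * b) \<le> 1 + \<bar>\<xi>\<bar> * \<bar>a\<bar> + \<xi>\<^sup>2 * \<bar>b\<bar>"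
      by (intro norm_triangle_mono) (simp_all add: norm_mult abs_mult del: of_real_mult of_real_power)
    also have "\<dots> \<le> B + 1 * B + 1 * B"
      using B \<xi> \<xi>2 by (intro add_mono mult_mono) auto
    finally show ?thesis by simp
  qed
  define w where "w = 1 + \<i> * \<xi> * a + \<xi>\<^sup>2 * b"
  have exp_eq: "iexp (\<xi> * f) = e + (1 + \<i> * \<xi> * f - \<xi>\<^sup>2 * f\<^sup>2 / 2)"
    by (simp add: e_def)
  \<comment> \<open>The identity is isolated over generic complex numbers with
    \<open>j * j = -1\<close>, away from the coercions. Its right-hand side lists all terms beyond
    order 2.\<close>
  have ring: "(e + (1 + j * x * f' - x\<^sup>2 * f'\<^sup>2 / 2)) * (1 + j * x * a' + x\<^sup>2 * b')
      - (1 + j * x * (f' + a') + x\<^sup>2 * (b' - f' * a' - f'\<^sup>2 / 2)) =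
      e * (1 + j * x * a' + x\<^sup>2 * b') + j * x ^ 3 * (f' * b') - j * x ^ 3 * (f'\<^sup>2 * a' / 2)
      - x\<^sup>2 * x\<^sup>2 * (f'\<^sup>2 * b' / 2)" if "j * j = -1" for j x f' a' b' e :: complex
  proof -
    have *: "j * (j * z) = - z" for z
      using that by (simp flip: mult.assoc)
    define h where "h = f'\<^sup>2 / 2"
    have "(e + (1 + j * x * f' - x\<^sup>2 * h)) * (1 + j * x * a' + x\<^sup>2 * b')
      - (1 + j * x * (f' + a') + x\<^sup>2 * (b' - f' * a' - h)) =
      e * (1 + j * x * a' + x\<^sup>2 * b') + j * x ^ 3 * (f' * b') - j * x ^ 3 * (h * a') - x\<^sup>2 * x\<^sup>2 * (h * b')"
      by (simp add: algebra_simps * power2_eq_square power3_eq_cube)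
    then show ?thesis
      by (simp add: h_def)
  qed
  have "iexp (\<xi> * f) * (1 + \<i> * \<xi> * a + \<xi>\<^sup>2 * b) - (1 + \<i> * \<xi> * (f + a) + \<xi>\<^sup>2 * (b - f * a - f\<^sup>2 / 2)) =
      e * w + \<i> * \<xi> ^ 3 * (f * b) - \<i> * \<xi> ^ 3 * (f\<^sup>2 * a / 2) - \<xi>\<^sup>2 * \<xi>\<^sup>2 * (f\<^sup>2 * b / 2)"
    unfolding exp_eq w_def unfolding of_real_mult of_real_power of_real_add of_real_diff of_real_divide of_real_numeral
    by (rule ring) simp
  also have "cmod \<dots> \<le> cmod (e * w) + cmod (\<i> * \<xi> ^ 3 * (f * b))
      + cmod (\<i> * \<xi> ^ 3 * (f\<^sup>2 * a / 2)) + cmod (\<xi>\<^sup>2 * \<xi>\<^sup>2 * (f\<^sup>2 * b / 2))"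
    by (intro order.trans[OF norm_triangle_ineq4] add_right_mono norm_triangle_ineq)
  also have "\<dots> = cmod e * cmod w + \<bar>\<xi>\<bar> ^ 3 * (\<bar>f\<bar> * \<bar>b\<bar>)
      + \<bar>\<xi>\<bar> ^ 3 * (\<bar>f\<bar>\<^sup>2 * \<bar>a\<bar> / 2) + \<xi>\<^sup>2 * \<xi>\<^sup>2 * (\<bar>f\<bar>\<^sup>2 * \<bar>b\<bar> / 2)"
    by (simp add: norm_mult norm_power norm_divide)
  also have "\<dots> \<le> \<bar>\<xi>\<bar> ^ 3 * B ^ 3 / 6 * (3 * B) + \<bar>\<xi>\<bar> ^ 3 * (B * B)
      + \<bar>\<xi>\<bar> ^ 3 * (B\<^sup>2 * B / 2) + \<bar>\<xi>\<bar> ^ 3 * (B\<^sup>2 * B / 2)"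
  proof (intro add_mono)
    have f2: "\<bar>f\<bar>\<^sup>2 \<le> B\<^sup>2" using B by (intro power_mono) auto
    have B0: "0 \<le> B" using B by simp
    show "cmod e * cmod w \<le> \<bar>\<xi>\<bar> ^ 3 * B ^ 3 / 6 * (3 * B)"
      using e w[folded w_def] by (rule mult_mono) (simp_all add: B0)
    show "\<bar>\<xi>\<bar> ^ 3 * (\<bar>f\<bar> * \<bar>b\<bar>) \<le> \<bar>\<xi>\<bar> ^ 3 * (B * B)"
      by (intro mult_left_mono mult_mono B) (simp_all add: B0)
    show "\<bar>\<xi>\<bar> ^ 3 * (\<bar>f\<bar>\<^sup>2 * \<bar>a\<bar> / 2) \<le> \<bar>\<xi>\<bar> ^ 3 * (B\<^sup>2 * B / 2)"
      by (intro mult_left_mono divide_right_mono mult_mono f2 B) (simp_all add: B0)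
    show "\<xi>\<^sup>2 * \<xi>\<^sup>2 * (\<bar>f\<bar>\<^sup>2 * \<bar>b\<bar> / 2) \<le> \<bar>\<xi>\<bar> ^ 3 * (B\<^sup>2 * B / 2)"
      by (intro mult_mono[of "\<xi>\<^sup>2 * \<xi>\<^sup>2"] \<xi>2 divide_right_mono mult_mono f2 B) (simp_all add: B0)
  qed
  also have "\<dots> = \<bar>\<xi>\<bar> ^ 3 * (B ^ 4 / 2 + B ^ 2 + B ^ 3)"
    by (simp add: algebra_simps power2_eq_square power3_eq_cube power4_eq_xxxx)
  \<comment> \<open>Since \<open>1 \<le> B\<close>, the lower powers are at most
    \<open>B ^ 4\<close>; the resulting factor 5/2 is then rounded up to 3.\<close>
  also have "\<dots> \<le> \<bar>\<xi>\<bar> ^ 3 * (B ^ 4 / 2 + B ^ 4 + B ^ 4)"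
    using B by (intro mult_left_mono add_mono order.refl power_increasing) simp_all
  also have "\<dots> \<le> \<bar>\<xi>\<bar> ^ 3 * (3 * B ^ 4)"
  proof (rule mult_left_mono)
    have "0 \<le> B ^ 4" using B by simp
    then show "B ^ 4 / 2 + B ^ 4 + B ^ 4 \<le> 3 * B ^ 4" by linarith
  qed simp
  finally show ?thesis
    by (simp add: mult_ac)
qed

text \<open>A discrete Gronwall estimate: each step adds an error \<open>\<delta>\<close>, and later
  steps amplify earlier errors by at most a power of \<open>R\<close>. As \<open>1 \<le> R\<close>,
  the single factor \<open>R ^ n\<close> dominates all these powers.\<close>

lemma approx_geometric:
  fixes A :: "nat \<Rightarrow> complex" and \<rho> R \<epsilon> \<delta> :: real
  assumes "cmod (A 1 - \<rho>) \<le> \<epsilon>" and "\<And>t. t \<ge> 1 \<Longrightarrow> cmod (A (Suc t) - \<rho> * A t) \<le> \<delta>"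
    and "\<bar>\<rho>\<bar> \<le> R" "1 \<le> R" "0 \<le> \<epsilon>" "0 \<le> \<delta>" and "n \<ge> 1"
  shows "cmod (A n - \<rho> ^ n) \<le> R ^ n * (\<epsilon> + n * \<delta>)"
  using \<open>n \<ge> 1\<close>
proof (induction n rule: dec_induct)
  case base
  have "\<epsilon> \<le> R * (\<epsilon> + \<delta>)"
    using mult_mono[of 1 R \<epsilon> "\<epsilon> + \<delta>"] assms by simp
  then show ?case using assms(1) by simp
next
  case (step n)
  have "cmod (A (Suc n) - \<rho> ^ Suc n) = cmod ((A (Suc n) - \<rho> * A n) + \<rho> * (A n - \<rho> ^ n))"
    by (simp add: algebra_simps)
  also have "\<dots> \<le> \<delta> + \<bar>\<rho>\<bar> * cmod (A n - \<rho> ^ n)"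
    using assms(2)[OF step.hyps(1)] by (intro norm_triangle_mono) (auto simp: norm_mult)
  also have "\<dots> \<le> R ^ Suc n * \<delta> + R * (R ^ n * (\<epsilon> + n * \<delta>))"
  proof (intro add_mono mult_mono)
    show "\<delta> \<le> R ^ Suc n * \<delta>"
      using one_le_power[OF \<open>1 \<le> R\<close>, of "Suc n"] \<open>0 \<le> \<delta>\<close> using mult_right_mono[of 1 "R ^ Suc n" \<delta>] by simp
  qed (use assms step in auto)
  also have "\<dots> = R ^ Suc n * (\<epsilon> + Suc n * \<delta>)"
    by (simp add: algebra_simps)
  finally show ?case .
qed

context finite_markov_chain
begin

lemma bounded_on_states:
  fixes f :: "'s \<Rightarrow> real"
  obtains B where "1 \<le> B" "\<And>x. x \<in> \<Omega> \<Longrightarrow> \<bar>f x\<bar> \<le> B"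
proof
  show "1 \<le> 1 + (\<Sum>x\<in>\<Omega>. \<bar>f x\<bar>)"
    by (simp add: sum_nonneg)
  show "\<bar>f x\<bar> \<le> 1 + (\<Sum>x\<in>\<Omega>. \<bar>f x\<bar>)" if "x \<in> \<Omega>" for x
    using member_le_sum[OF that, of "\<lambda>x. \<bar>f x\<bar>"] finite_states by simp
qed

text \<open>The Green-Kubo formula: for centred \<open>f\<close>, \<open>step (poisson f)\<close> is
  the sum over \<open>k \<ge> 1\<close> of the \<open>k\<close>-step averages of \<open>f\<close>,
  so this is the stationary variance plus twice the sum of the autocovariances.\<close>

definition asymptotic_variance :: "('s \<Rightarrow> real) \<Rightarrow> real" where
  "asymptotic_variance f = mean (\<lambda>x. (f x)\<^sup>2) + 2 * mean (\<lambda>x. f x * step (poisson f) x)"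

text \<open>The first-order corrector \<open>a\<close> absorbs the term of order \<open>\<xi>\<close> and \<open>b\<close> replaces the
  state-dependent term of order \<open>\<xi>\<^sup>2\<close> by its stationary mean, so that one step of the chain
  multiplies the corrected characteristic function by \<open>1 - \<xi>\<^sup>2 v / 2\<close> up to \<open>O(\<xi>\<^sup>3)\<close>.\<close>

lemma char_recursion:
  fixes f :: "'s \<Rightarrow> real"
  assumes f: "mean f = 0"
  defines "v \<equiv> asymptotic_variance f"
  shows "\<exists>(a :: 's \<Rightarrow> real) (b :: 's \<Rightarrow> real) B K. 1 \<le> B \<and> 0 \<le> K \<and>
    (\<forall>x\<in>\<Omega>. \<bar>f x\<bar> \<le> B \<and> \<bar>a x\<bar> \<le> B \<and> \<bar>b x\<bar> \<le> B) \<and>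
    (\<forall>\<xi>::real. \<forall>x\<in>\<Omega>. \<bar>\<xi>\<bar> \<le> 1 \<longrightarrow>
      cmod ((\<Sum>y\<in>\<Omega>. P x y *\<^sub>R (iexp (\<xi> * f y) * (1 + \<i> * \<xi> * a y + \<xi>\<^sup>2 * b y))) -
        (1 - \<xi>\<^sup>2 * v / 2) * (1 + \<i> * \<xi> * a x + \<xi>\<^sup>2 * b x)) \<le> K * \<bar>\<xi>\<bar> ^ 3)"
proof -
  define a where "a = step (poisson f)"
  \<comment> \<open>The coefficient of \<open>\<xi>\<^sup>2\<close> after one step is
    \<open>b - q\<close>. Since the stationary mean of \<open>q\<close> is \<open>v / 2\<close>,
    solving Poisson's equation for \<open>q\<close> lets \<open>b\<close> replace \<open>q\<close>
    by that constant.\<close>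
  define q where "q = (\<lambda>x. f x * a x + (f x)\<^sup>2 / 2)"
  define b where "b = (\<lambda>x. - step (poisson q) x)"
  have q: "mean q = v / 2"
    by (simp add: v_def asymptotic_variance_def mean_def q_def a_def algebra_simps sum.distrib sum_divide_distrib[symmetric])
  \<comment> \<open>Poisson's equation says \<open>f + a = poisson f\<close> on the states, so one
    step reproduces the coefficient \<open>a\<close> of order \<open>\<xi>\<close>.\<close>
  have a_eq: "step (\<lambda>y. f y + a y) x = a x" for x
  proof -
    have "step (\<lambda>y. f y + a y) = step (poisson f)"
      using poisson_equation[of _ f] f by (intro step_cong) (simp add: a_def algebra_simps)
    then show ?thesis by (simp add: a_def)
  qed
  have b_eq: "step (\<lambda>y. b y - f y * a y - (f y)\<^sup>2 / 2) x = b x - v / 2" if "x \<in> \<Omega>" for x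
  proof -
    have "step (\<lambda>y. b y - f y * a y - (f y)\<^sup>2 / 2) x = step (\<lambda>y. - poisson q y - v / 2) x"
    proof (intro fun_cong[OF step_cong])
      fix y assume "y \<in> \<Omega>"
      then have "poisson q y - step (poisson q) y = q y - v / 2"
        using poisson_equation[of y q] q by simp
      moreover have "f y * a y + (f y)\<^sup>2 / 2 = q y"
        by (simp add: q_def)
      ultimately show "b y - f y * a y - (f y)\<^sup>2 / 2 = - poisson q y - v / 2"
        by (simp add: b_def)
    qed
    also have "\<dots> = b x - v / 2"
      using P_sum[OF that]
      by (simp add: b_def kernel_step_def right_diff_distrib sum_subtractf sum_negf flip: sum_distrib_right sum_divide_distrib)
    finally show ?thesis .
  qed
  obtain B1 B2 B3 where B123: "1 \<le> B1" "\<And>x. x \<in> \<Omega> \<Longrightarrow> \<bar>f x\<bar> \<le> B1"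
      "1 \<le> B2" "\<And>x. x \<in> \<Omega> \<Longrightarrow> \<bar>a x\<bar> \<le> B2"
      "1 \<le> B3" "\<And>x. x \<in> \<Omega> \<Longrightarrow> \<bar>b x\<bar> \<le> B3"
    using bounded_on_states[of f] bounded_on_states[of a] bounded_on_states[of b] by metis
  define B where "B = max B1 (max B2 B3)"
  have B: "1 \<le> B" "\<And>x. x \<in> \<Omega> \<Longrightarrow> \<bar>f x\<bar> \<le> B" "\<And>x. x \<in> \<Omega> \<Longrightarrow> \<bar>a x\<bar> \<le> B" "\<And>x. x \<in> \<Omega> \<Longrightarrow> \<bar>b x\<bar> \<le> B"
    using B123 by (auto simp: B_def le_max_iff_disj)
  show ?thesis
  proof (rule exI[of _ a], rule exI[of _ b], rule exI[of _ B], rule exI[of _ "3 * B ^ 4 + \<bar>v\<bar> * B"],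
      intro conjI allI ballI impI)
    fix \<xi> :: real and x assume \<xi>: "\<bar>\<xi>\<bar> \<le> 1" and x: "x \<in> \<Omega>"
    let ?w = "\<lambda>y. 1 + \<i> * \<xi> * a y + \<xi>\<^sup>2 * b y"
    let ?z = "\<lambda>y. 1 + \<i> * \<xi> * (f y + a y) + \<xi>\<^sup>2 * (b y - f y * a y - (f y)\<^sup>2 / 2)"
    have z: "(\<Sum>y\<in>\<Omega>. P x y *\<^sub>R ?z y) = 1 + \<i> * \<xi> * a x + \<xi>\<^sup>2 * (b x - v / 2)"
    proof -
      have "(\<Sum>y\<in>\<Omega>. P x y *\<^sub>R ?z y) = of_real (\<Sum>y\<in>\<Omega>. P x y) + \<i> * \<xi> * of_real (step (\<lambda>y. f y + a y) x)
          + \<xi>\<^sup>2 * of_real (step (\<lambda>y. b y - f y * a y - (f y)\<^sup>2 / 2) x)"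
        unfolding kernel_step_def of_real_sum sum_distrib_left sum.distrib[symmetric]
        by (intro sum.cong refl) (simp add: scaleR_conv_of_real algebra_simps)
      then show ?thesis by (simp add: P_sum[OF x] a_eq b_eq[OF x])
    qed
    have "cmod ((\<Sum>y\<in>\<Omega>. P x y *\<^sub>R (iexp (\<xi> * f y) * ?w y)) - (\<Sum>y\<in>\<Omega>. P x y *\<^sub>R ?z y))
        = cmod (\<Sum>y\<in>\<Omega>. P x y *\<^sub>R (iexp (\<xi> * f y) * ?w y - ?z y))"
      by (simp only: scaleR_diff_right sum_subtractf)
    also have "\<dots> \<le> (\<Sum>y\<in>\<Omega>. P x y * (3 * B ^ 4 * \<bar>\<xi>\<bar> ^ 3))"
    proof (rule sum_norm_le)
      fix y assume y: "y \<in> \<Omega>"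
      have "cmod (iexp (\<xi> * f y) * ?w y - ?z y) \<le> 3 * B ^ 4 * \<bar>\<xi>\<bar> ^ 3"
        using iexp_mult_expansion[OF B(1) B(2)[OF y] B(3)[OF y] B(4)[OF y] \<xi>] by simp
      then show "cmod (P x y *\<^sub>R (iexp (\<xi> * f y) * ?w y - ?z y)) \<le> P x y * (3 * B ^ 4 * \<bar>\<xi>\<bar> ^ 3)"
        unfolding norm_scaleR using P_nonneg[OF x y] by (simp only: abs_of_nonneg mult_left_mono)
    qed
    also have "\<dots> = 3 * B ^ 4 * \<bar>\<xi>\<bar> ^ 3"
      using P_sum[OF x] by (simp add: sum_distrib_right[symmetric])
    finally have 1: "cmod ((\<Sum>y\<in>\<Omega>. P x y *\<^sub>R (iexp (\<xi> * f y) * ?w y)) - (\<Sum>y\<in>\<Omega>. P x y *\<^sub>R ?z y)) \<le> 3 * B ^ 4 * \<bar>\<xi>\<bar> ^ 3" .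
    \<comment> \<open>Up to order 2 the two expressions agree; the difference is the product of
      \<open>\<xi>\<^sup>2 * v / 2\<close> with the non-constant terms of
      \<open>?w x\<close>.\<close>
    have "(\<Sum>y\<in>\<Omega>. P x y *\<^sub>R ?z y) - (1 - \<xi>\<^sup>2 * v / 2) * ?w x =
        \<xi> ^ 3 * (v / 2) * (\<i> * a x + \<xi> * b x)"
      unfolding z by (simp add: algebra_simps power2_eq_square power3_eq_cube)
    also have "cmod \<dots> \<le> \<bar>\<xi>\<bar> ^ 3 * (\<bar>v\<bar> / 2) * (B + 1 * B)"
    proof -
      have "cmod (\<i> * a x + \<xi> * b x) \<le> \<bar>a x\<bar> + \<bar>\<xi>\<bar> * \<bar>b x\<bar>"
        by (intro norm_triangle_mono) (auto simp: norm_mult)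
      also have "\<dots> \<le> B + 1 * B"
        using B x \<xi> by (intro add_mono mult_mono) auto
      finally have "\<bar>\<xi>\<bar> ^ 3 * (\<bar>v\<bar> / 2) * cmod (\<i> * a x + \<xi> * b x) \<le> \<bar>\<xi>\<bar> ^ 3 * (\<bar>v\<bar> / 2) * (B + 1 * B)"
        by (rule mult_left_mono) simp
      then show ?thesis
        by (simp only: norm_mult norm_power norm_divide norm_of_real norm_numeral abs_mult power_abs abs_divide abs_numeral)
    qed
    finally have 2: "cmod ((\<Sum>y\<in>\<Omega>. P x y *\<^sub>R ?z y) - (1 - \<xi>\<^sup>2 * v / 2) * ?w x) \<le> \<bar>v\<bar> * B * \<bar>\<xi>\<bar> ^ 3"
      by (simp add: mult_ac)
    show "cmod ((\<Sum>y\<in>\<Omega>. P x y *\<^sub>R (iexp (\<xi> * f y) * ?w y)) - (1 - \<xi>\<^sup>2 * v / 2) * ?w x) \<le> (3 * B ^ 4 + \<bar>v\<bar> * B) * \<bar>\<xi>\<bar> ^ 3"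
      using norm_triangle_le[OF add_mono[OF 1 2]] by (simp add: algebra_simps)
  qed (use B in auto)
qed

section \<open>Partial sums along the chain and their characteristic functions\<close>

definition csum :: "('s \<Rightarrow> real) \<Rightarrow> nat \<Rightarrow> 'a \<Rightarrow> real" where
  "csum f t \<omega> = (\<Sum>i=1..t. f (Y i \<omega>))"

lemma csum_Suc: "csum f (Suc t) \<omega> = csum f t \<omega> + f (Y (Suc t) \<omega>)"
  by (simp add: csum_def)

lemma csum_history: "csum f t \<omega> = (\<Sum>i=1..t. f (history t \<omega> i))"
  by (simp add: csum_def history_def)

lemma history_last: "t \<ge> 1 \<Longrightarrow> Y t \<omega> = history t \<omega> t"
  by (simp add: history_def)

lemma integrable_csum_last:
  fixes F :: "real \<Rightarrow> 's \<Rightarrow> 'b :: {banach, second_countable_topology}"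
  shows "t \<ge> 1 \<Longrightarrow> integrable M (\<lambda>\<omega>. F (csum f t \<omega>) (Y t \<omega>))"
  using integrable_history[of "\<lambda>h. F (\<Sum>i=1..t. f (h i)) (h t)" t]
  by (simp add: csum_history history_last)

lemma integrable_csum:
  fixes F :: "real \<Rightarrow> 'b :: {banach, second_countable_topology}"
  shows "integrable M (\<lambda>\<omega>. F (csum f t \<omega>))"
  using integrable_history[of "\<lambda>h. F (\<Sum>i=1..t. f (h i))" t]
  by (simp add: csum_history)

lemma expectation_csum_step:
  fixes F :: "real \<Rightarrow> 's \<Rightarrow> 's \<Rightarrow> 'b :: {banach, second_countable_topology}"
  assumes "t \<ge> 1"
  shows "expectation (\<lambda>\<omega>. F (csum f t \<omega>) (Y t \<omega>) (Y (Suc t) \<omega>)) =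
    expectation (\<lambda>\<omega>. \<Sum>y\<in>\<Omega>. P (Y t \<omega>) y *\<^sub>R F (csum f t \<omega>) (Y t \<omega>) y)"
  using expectation_step[OF assms, of "\<lambda>h y. F (\<Sum>i=1..t. f (h i)) (h t) y"] assms
  by (simp add: csum_history history_last[of t])

lemma norm_expectation_le:
  fixes F :: "'a \<Rightarrow> 'b :: {banach, second_countable_topology}"
  assumes "integrable M F" "\<And>\<omega>. \<omega> \<in> space M \<Longrightarrow> norm (F \<omega>) \<le> K"
  shows "norm (expectation F) \<le> K"
proof -
  have "norm (expectation F) \<le> expectation (\<lambda>\<omega>. norm (F \<omega>))"
    by (rule integral_norm_bound)
  also have "\<dots> \<le> expectation (\<lambda>_. K)"
    using assms by (intro integral_mono) auto
  finally show ?thesis by (simp add: prob_space)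
qed

text \<open>The corrected characteristic function obeys an approximate geometric recursion, and
  removing the corrector costs \<open>2 * B * \<bar>\<xi>\<bar>\<close>. The constants are uniform
  in \<open>\<xi>\<close>, \<open>R\<close> and \<open>n\<close>, so that \<open>\<xi>\<close> and
  \<open>R\<close> may later depend on \<open>n\<close>.\<close>

lemma csum_char_estimate:
  fixes f :: "'s \<Rightarrow> real"
  assumes f: "mean f = 0"
  defines "v \<equiv> asymptotic_variance f"
  shows "\<exists>B K. 0 \<le> B \<and> 0 \<le> K \<and> (\<forall>(\<xi>::real) R n. \<bar>\<xi>\<bar> \<le> 1 \<longrightarrow> n \<ge> 1 \<longrightarrow> 1 + \<bar>\<xi>\<^sup>2 * v / 2\<bar> \<le> R \<longrightarrow>
      cmod (expectation (\<lambda>\<omega>. iexp (\<xi> * csum f n \<omega>)) - (1 - \<xi>\<^sup>2 * v / 2) ^ n) \<le>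
        2 * B * \<bar>\<xi>\<bar> + R ^ n * ((3 * B + \<bar>v\<bar>) * \<bar>\<xi>\<bar> + n * (K * \<bar>\<xi>\<bar> ^ 3)))"
proof -
  obtain a b :: "'s \<Rightarrow> real" and B K :: real where BK: "1 \<le> B" "0 \<le> K"
    and abf: "\<forall>x\<in>\<Omega>. \<bar>f x\<bar> \<le> B \<and> \<bar>a x\<bar> \<le> B \<and> \<bar>b x\<bar> \<le> B"
    and rec: "\<forall>\<xi>::real. \<forall>x\<in>\<Omega>. \<bar>\<xi>\<bar> \<le> 1 \<longrightarrow>
      cmod ((\<Sum>y\<in>\<Omega>. P x y *\<^sub>R (iexp (\<xi> * f y) * (1 + \<i> * \<xi> * a y + \<xi>\<^sup>2 * b y))) -
        (1 - \<xi>\<^sup>2 * v / 2) * (1 + \<i> * \<xi> * a x + \<xi>\<^sup>2 * b x)) \<le> K * \<bar>\<xi>\<bar> ^ 3"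
    using char_recursion[OF f, folded v_def] by (elim exE conjE) (rule that)
  have fb: "\<bar>f x\<bar> \<le> B" and ab: "\<bar>a x\<bar> \<le> B" and bb: "\<bar>b x\<bar> \<le> B" if "x \<in> \<Omega>" for x
    using abf that by blast+
  show ?thesis
  proof (rule exI[of _ B], rule exI[of _ K], intro conjI allI impI)
    fix \<xi> R :: real and n :: nat
    assume \<xi>: "\<bar>\<xi>\<bar> \<le> 1" and n: "n \<ge> 1" and R: "1 + \<bar>\<xi>\<^sup>2 * v / 2\<bar> \<le> R"
    define \<rho> where "\<rho> = 1 - \<xi>\<^sup>2 * v / 2"
    define w where "w y = 1 + \<i> * \<xi> * a y + \<xi>\<^sup>2 * b y" for y
    define A where "A t = expectation (\<lambda>\<omega>. iexp (\<xi> * csum f t \<omega>) * w (Y t \<omega>))" for t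
    have \<xi>2: "\<xi>\<^sup>2 \<le> \<bar>\<xi>\<bar>"
      using mult_left_mono[OF \<xi>, of "\<bar>\<xi>\<bar>"] by (simp add: power2_eq_square)
    have w: "cmod (w y - 1) \<le> 2 * B * \<bar>\<xi>\<bar>" if "y \<in> \<Omega>" for y
    proof -
      have "w y - 1 = \<i> * \<xi> * a y + \<xi>\<^sup>2 * b y"
        by (simp add: w_def)
      also have "cmod \<dots> \<le> \<bar>\<xi>\<bar> * \<bar>a y\<bar> + \<xi>\<^sup>2 * \<bar>b y\<bar>"
        by (intro norm_triangle_mono) (simp_all add: norm_mult abs_mult del: of_real_mult of_real_power)
      also have "\<dots> \<le> \<bar>\<xi>\<bar> * B + \<bar>\<xi>\<bar> * B"
        using \<xi>2 ab[OF that] bb[OF that] by (intro add_mono mult_mono) auto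
      finally show ?thesis by simp
    qed
    have int: "integrable M (\<lambda>\<omega>. iexp (\<xi> * csum f t \<omega>) * w (Y t \<omega>))" if "t \<ge> 1" for t
      using integrable_csum_last[OF that, of "\<lambda>s y. iexp (\<xi> * s) * w y"] .
    have int1: "integrable M (\<lambda>\<omega>. iexp (\<xi> * csum f t \<omega>))" for t
      using integrable_csum[of "\<lambda>s. iexp (\<xi> * s)"] .
    \<comment> \<open>Whatever the law of \<open>Y 1\<close>, the corrector contributes
      \<open>2 * B\<close> and the exponential \<open>B\<close> to the distance from 1; the distance
      from 1 to \<open>\<rho>\<close> accounts for \<open>\<bar>v\<bar>\<close>.\<close>
    have A1: "cmod (A 1 - \<rho>) \<le> (3 * B + \<bar>v\<bar>) * \<bar>\<xi>\<bar>"
    proof -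
      have bound: "cmod (iexp (\<xi> * csum f 1 \<omega>) * w (Y 1 \<omega>) - 1) \<le> 3 * B * \<bar>\<xi>\<bar>" if "\<omega> \<in> space M" for \<omega>
      proof -
        let ?e = "iexp (\<xi> * csum f 1 \<omega>)"
        have y: "Y 1 \<omega> \<in> \<Omega>" using Y_in[OF _ that] by simp
        have "cmod (?e - 1) \<le> \<bar>\<xi> * f (Y 1 \<omega>)\<bar>"
          using iexp_approx1[of "\<xi> * csum f 1 \<omega>" 0] by (simp add: csum_def)
        also have "\<dots> \<le> \<bar>\<xi>\<bar> * B"
          using fb[OF y] by (simp add: abs_mult mult_left_mono)
        finally have e: "cmod (?e - 1) \<le> \<bar>\<xi>\<bar> * B" .
        have "?e * w (Y 1 \<omega>) - 1 = ?e * (w (Y 1 \<omega>) - 1) + (?e - 1)"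
          by (simp add: algebra_simps)
        also have "cmod \<dots> \<le> 2 * B * \<bar>\<xi>\<bar> + \<bar>\<xi>\<bar> * B"
          using w[OF y] e by (intro norm_triangle_mono) (simp_all add: norm_mult)
        finally show ?thesis by simp
      qed
      have "A 1 - 1 = expectation (\<lambda>\<omega>. iexp (\<xi> * csum f 1 \<omega>) * w (Y 1 \<omega>) - 1)"
        unfolding A_def using int[of 1] by (subst Bochner_Integration.integral_diff) (simp_all add: prob_space)
      also have "cmod \<dots> \<le> 3 * B * \<bar>\<xi>\<bar>"
        using int[of 1] bound by (intro norm_expectation_le) simp_all
      finally have 1: "cmod (A 1 - 1) \<le> 3 * B * \<bar>\<xi>\<bar>" .
      have "cmod (1 - complex_of_real \<rho>) = \<bar>\<xi>\<^sup>2 * v / 2\<bar>"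
        unfolding \<rho>_def of_real_diff by (simp del: of_real_mult of_real_power of_real_divide)
      also have "\<dots> = \<xi>\<^sup>2 * \<bar>v\<bar> / 2"
        by (simp add: abs_mult)
      also have "\<dots> \<le> \<xi>\<^sup>2 * \<bar>v\<bar>" by simp
      also have "\<dots> \<le> \<bar>\<xi>\<bar> * \<bar>v\<bar>"
        using \<xi>2 by (intro mult_right_mono) auto
      finally have 2: "cmod (1 - complex_of_real \<rho>) \<le> \<bar>\<xi>\<bar> * \<bar>v\<bar>" .
      show ?thesis
        using norm_triangle_le[OF add_mono[OF 1 2]] by (simp add: algebra_simps)
    qed
    \<comment> \<open>The last exponential factor is split off and averaged over the next state; the
      remaining factor \<open>iexp (\<xi> * csum f t \<omega>)\<close> has modulus 1, so the
      one-step bound for the states passes to the expectation.\<close>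
    have A_Suc: "cmod (A (Suc t) - \<rho> * A t) \<le> K * \<bar>\<xi>\<bar> ^ 3" if t: "t \<ge> 1" for t
    proof -
      let ?s = "\<lambda>x. (\<Sum>y\<in>\<Omega>. P x y *\<^sub>R (iexp (\<xi> * f y) * w y))"
      have "A (Suc t) = expectation (\<lambda>\<omega>. (\<lambda>s x y. iexp (\<xi> * s) * (iexp (\<xi> * f y) * w y)) (csum f t \<omega>) (Y t \<omega>) (Y (Suc t) \<omega>))"
        unfolding A_def by (simp add: csum_Suc distrib_left exp_add mult.assoc)
      also have "\<dots> = expectation (\<lambda>\<omega>. iexp (\<xi> * csum f t \<omega>) * ?s (Y t \<omega>))"
        using expectation_csum_step[OF t, of "\<lambda>s x y. iexp (\<xi> * s) * (iexp (\<xi> * f y) * w y)" f]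
        by (simp only: sum_distrib_left mult_scaleR_right)
      finally have "A (Suc t) - \<rho> * A t =
          expectation (\<lambda>\<omega>. iexp (\<xi> * csum f t \<omega>) * ?s (Y t \<omega>) - \<rho> * (iexp (\<xi> * csum f t \<omega>) * w (Y t \<omega>)))"
        using integrable_csum_last[OF t, of "\<lambda>s y. iexp (\<xi> * s) * ?s y"] int[OF t]
        unfolding A_def by (subst Bochner_Integration.integral_diff) (simp_all only: integrable_mult_right integral_mult_right_zero)
      also have "cmod \<dots> \<le> K * \<bar>\<xi>\<bar> ^ 3"
      proof (rule norm_expectation_le)
        show "integrable M (\<lambda>\<omega>. iexp (\<xi> * csum f t \<omega>) * ?s (Y t \<omega>) - \<rho> * (iexp (\<xi> * csum f t \<omega>) * w (Y t \<omega>)))"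
          using integrable_csum_last[OF t, of "\<lambda>s y. iexp (\<xi> * s) * ?s y - \<rho> * (iexp (\<xi> * s) * w y)"] .
        fix \<omega> assume "\<omega> \<in> space M"
        then have y: "Y t \<omega> \<in> \<Omega>" using Y_in[OF t] by simp
        have "iexp (\<xi> * csum f t \<omega>) * ?s (Y t \<omega>) - \<rho> * (iexp (\<xi> * csum f t \<omega>) * w (Y t \<omega>)) =
            iexp (\<xi> * csum f t \<omega>) * (?s (Y t \<omega>) - \<rho> * w (Y t \<omega>))"
          by (simp only: right_diff_distrib mult.left_commute)
        also have "cmod \<dots> = cmod (?s (Y t \<omega>) - \<rho> * w (Y t \<omega>))"
          unfolding norm_mult norm_exp_i_times by simp
        also have "\<dots> \<le> K * \<bar>\<xi>\<bar> ^ 3"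
          using rec[rule_format, OF y \<xi>] by (simp add: w_def \<rho>_def)
        finally show "cmod (iexp (\<xi> * csum f t \<omega>) * ?s (Y t \<omega>) - \<rho> * (iexp (\<xi> * csum f t \<omega>) * w (Y t \<omega>))) \<le> K * \<bar>\<xi>\<bar> ^ 3" .
      qed
      finally show ?thesis .
    qed
    have "cmod (A n - \<rho> ^ n) \<le> R ^ n * ((3 * B + \<bar>v\<bar>) * \<bar>\<xi>\<bar> + n * (K * \<bar>\<xi>\<bar> ^ 3))"
      using A1 A_Suc
    proof (rule approx_geometric)
      show "\<bar>\<rho>\<bar> \<le> R" "1 \<le> R"
        using R unfolding \<rho>_def by linarith+
    qed (use BK n in auto)
    moreover have "cmod (expectation (\<lambda>\<omega>. iexp (\<xi> * csum f n \<omega>)) - A n) \<le> 2 * B * \<bar>\<xi>\<bar>"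
    proof -
      have "expectation (\<lambda>\<omega>. iexp (\<xi> * csum f n \<omega>)) - A n =
          expectation (\<lambda>\<omega>. iexp (\<xi> * csum f n \<omega>) - iexp (\<xi> * csum f n \<omega>) * w (Y n \<omega>))"
        unfolding A_def using int1 int[OF n] by (subst Bochner_Integration.integral_diff) simp_all
      also have "cmod \<dots> \<le> 2 * B * \<bar>\<xi>\<bar>"
      proof (rule norm_expectation_le)
        show "integrable M (\<lambda>\<omega>. iexp (\<xi> * csum f n \<omega>) - iexp (\<xi> * csum f n \<omega>) * w (Y n \<omega>))"
          using int1 int[OF n] by (rule Bochner_Integration.integrable_diff)
        fix \<omega> assume "\<omega> \<in> space M"
        then have y: "Y n \<omega> \<in> \<Omega>" using Y_in[OF n] by simp
        have "iexp (\<xi> * csum f n \<omega>) - iexp (\<xi> * csum f n \<omega>) * w (Y n \<omega>) = iexp (\<xi> * csum f n \<omega>) * (1 - w (Y n \<omega>))"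
          by (simp add: right_diff_distrib)
        also have "cmod \<dots> = cmod (w (Y n \<omega>) - 1)"
          unfolding norm_mult norm_exp_i_times by (simp add: norm_minus_commute)
        finally show "cmod (iexp (\<xi> * csum f n \<omega>) - iexp (\<xi> * csum f n \<omega>) * w (Y n \<omega>)) \<le> 2 * B * \<bar>\<xi>\<bar>"
          using w[OF y] by simp
      qed
      finally show ?thesis .
    qed
    ultimately have "cmod ((expectation (\<lambda>\<omega>. iexp (\<xi> * csum f n \<omega>)) - A n) + (A n - \<rho> ^ n)) \<le>
        2 * B * \<bar>\<xi>\<bar> + R ^ n * ((3 * B + \<bar>v\<bar>) * \<bar>\<xi>\<bar> + n * (K * \<bar>\<xi>\<bar> ^ 3))"
      by (intro norm_triangle_mono) simp_all
    then show "cmod (expectation (\<lambda>\<omega>. iexp (\<xi> * csum f n \<omega>)) - (1 - \<xi>\<^sup>2 * v / 2) ^ n) \<le>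
        2 * B * \<bar>\<xi>\<bar> + R ^ n * ((3 * B + \<bar>v\<bar>) * \<bar>\<xi>\<bar> + n * (K * \<bar>\<xi>\<bar> ^ 3))"
      by (simp add: \<rho>_def)
  qed (use BK in auto)
qed

text \<open>With \<open>\<xi> = u / sqrt n\<close> the power
  \<open>(1 - \<xi>\<^sup>2 * v / 2) ^ n\<close> tends to the Gaussian exponential. The accumulated
  error \<open>n * \<bar>\<xi>\<bar> ^ 3\<close> is of order \<open>1 / sqrt n\<close>, as are the
  boundary terms.\<close>

lemma csum_char_tendsto:
  fixes f :: "'s \<Rightarrow> real" and u :: real
  assumes f: "mean f = 0"
  shows "(\<lambda>n. expectation (\<lambda>\<omega>. iexp (u / sqrt n * csum f n \<omega>)))
    \<longlonglongrightarrow> complex_of_real (exp (- (u\<^sup>2 * asymptotic_variance f / 2)))"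
proof -
  define v where "v = asymptotic_variance f"
  \<comment> \<open>Bounds \<open>R ^ n\<close> uniformly in \<open>n\<close> for the choice
    \<open>R = 1 + \<bar>u\<^sup>2 * v / 2\<bar> / n\<close>.\<close>
  define E where "E = exp (\<bar>u\<^sup>2 * v / 2\<bar>)"
  obtain B K where BK: "0 \<le> B" "0 \<le> K"
    and est: "\<forall>(\<xi>::real) R n. \<bar>\<xi>\<bar> \<le> 1 \<longrightarrow> n \<ge> 1 \<longrightarrow> 1 + \<bar>\<xi>\<^sup>2 * v / 2\<bar> \<le> R \<longrightarrow>
      cmod (expectation (\<lambda>\<omega>. iexp (\<xi> * csum f n \<omega>)) - (1 - \<xi>\<^sup>2 * v / 2) ^ n) \<le>
        2 * B * \<bar>\<xi>\<bar> + R ^ n * ((3 * B + \<bar>v\<bar>) * \<bar>\<xi>\<bar> + n * (K * \<bar>\<xi>\<bar> ^ 3))"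
    using csum_char_estimate[OF f, folded v_def] by (elim exE conjE) (rule that)
  define D where "D = 2 * B * \<bar>u\<bar> + E * ((3 * B + \<bar>v\<bar>) * \<bar>u\<bar> + K * \<bar>u\<bar> ^ 3)"
  have le: "cmod (expectation (\<lambda>\<omega>. iexp (u / sqrt n * csum f n \<omega>)) - of_real ((1 + (- (u\<^sup>2 * v / 2)) / n) ^ n)) \<le> D * (1 / sqrt n)"
    if n: "n \<ge> 1" "u\<^sup>2 \<le> n" for n :: nat
  proof -
    let ?\<xi> = "u / sqrt n" and ?R = "1 + \<bar>u\<^sup>2 * v / 2\<bar> / n"
    have n0: "0 < real n" using n by simp
    have sq: "?\<xi>\<^sup>2 = u\<^sup>2 / n" using n0 by (simp add: power_divide)
    have "?\<xi>\<^sup>2 \<le> 1" unfolding sq using n n0 by simp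
    then have \<xi>: "\<bar>?\<xi>\<bar> \<le> 1" by (simp only: abs_square_le_1)
    have Req: "1 + \<bar>?\<xi>\<^sup>2 * v / 2\<bar> \<le> ?R"
      unfolding sq using n0 by (simp add: abs_mult)
    have RE: "?R ^ n \<le> E"
    proof -
      have "?R ^ n \<le> exp (\<bar>u\<^sup>2 * v / 2\<bar> / n) ^ n"
        by (intro power_mono exp_ge_add_one_self) simp
      also have "\<dots> = E" using n0 by (simp add: E_def flip: exp_of_nat_mult)
      finally show ?thesis .
    qed
    have cube: "n * (K * \<bar>?\<xi>\<bar> ^ 3) = K * \<bar>u\<bar> ^ 3 / sqrt n"
    proof -
      have "sqrt n ^ 3 = n * sqrt n" using n0 by (simp add: power3_eq_cube)
      then show ?thesis using n0 by (simp add: power_divide abs_divide)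
    qed
    have "cmod (expectation (\<lambda>\<omega>. iexp (?\<xi> * csum f n \<omega>)) - (1 - ?\<xi>\<^sup>2 * v / 2) ^ n) \<le>
        2 * B * \<bar>?\<xi>\<bar> + ?R ^ n * ((3 * B + \<bar>v\<bar>) * \<bar>?\<xi>\<bar> + n * (K * \<bar>?\<xi>\<bar> ^ 3))"
      by (rule est[rule_format, OF \<xi> n(1) Req])
    also have "\<dots> \<le> 2 * B * \<bar>?\<xi>\<bar> + E * ((3 * B + \<bar>v\<bar>) * \<bar>?\<xi>\<bar> + n * (K * \<bar>?\<xi>\<bar> ^ 3))"
      using BK by (intro add_left_mono mult_right_mono RE) simp
    also have "\<dots> = D * (1 / sqrt n)"
      unfolding cube D_def using n0 by (simp add: abs_divide field_simps)
    finally show ?thesis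
      unfolding sq by (simp add: field_simps)
  qed
  have "(\<lambda>n. expectation (\<lambda>\<omega>. iexp (u / sqrt n * csum f n \<omega>)) - of_real ((1 + (- (u\<^sup>2 * v / 2)) / n) ^ n)) \<longlonglongrightarrow> 0"
  proof (rule Lim_null_comparison)
    show "\<forall>\<^sub>F n in sequentially. cmod (expectation (\<lambda>\<omega>. iexp (u / sqrt n * csum f n \<omega>)) - of_real ((1 + (- (u\<^sup>2 * v / 2)) / n) ^ n)) \<le> D * (1 / sqrt n)"
      \<comment> \<open>The second threshold ensures \<open>u\<^sup>2 \<le> n\<close>, that is
        \<open>\<bar>\<xi>\<bar> \<le> 1\<close>.\<close>
      using eventually_ge_at_top[of 1] eventually_ge_at_top[of "nat \<lceil>u\<^sup>2\<rceil>"]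
      by eventually_elim (rule le, simp_all add: nat_ceiling_le_eq)
    show "(\<lambda>n. D * (1 / sqrt (real n))) \<longlonglongrightarrow> 0"
      by real_asymp
  qed
  moreover have "(\<lambda>n. complex_of_real ((1 + (- (u\<^sup>2 * v / 2)) / n) ^ n)) \<longlonglongrightarrow> of_real (exp (- (u\<^sup>2 * v / 2)))"
    by (intro tendsto_of_real tendsto_exp_limit_sequentially)
  ultimately have "(\<lambda>n. expectation (\<lambda>\<omega>. iexp (u / sqrt n * csum f n \<omega>)) - of_real ((1 + (- (u\<^sup>2 * v / 2)) / n) ^ n)
      + complex_of_real ((1 + (- (u\<^sup>2 * v / 2)) / n) ^ n)) \<longlonglongrightarrow> 0 + of_real (exp (- (u\<^sup>2 * v / 2)))"
    by (rule tendsto_add)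
  then show ?thesis by (simp add: v_def)
qed

end

subsection \<open>Almost sure averages and temporal variance\<close>

text \<open>By monotone convergence the random series has finite expectation, hence is almost surely
  finite, and the terms of a convergent series vanish in the limit.\<close>

lemma (in prob_space) AE_tendsto_zero_if_summable_expectation:
  fixes Z :: "nat \<Rightarrow> 'a \<Rightarrow> real"
  assumes int: "\<And>n. integrable M (Z n)" and nonneg: "\<And>n \<omega>. 0 \<le> Z n \<omega>"
    and sum: "summable (\<lambda>n. expectation (Z n))"
  shows "AE \<omega> in M. (\<lambda>n. Z n \<omega>) \<longlonglongrightarrow> 0"
proof -
  have [measurable]: "Z n \<in> borel_measurable M" for n
    using int by (rule borel_measurable_integrable)
  have "(\<integral>\<^sup>+\<omega>. (\<Sum>n. ennreal (Z n \<omega>)) \<partial>M) = (\<Sum>n. \<integral>\<^sup>+\<omega>. ennreal (Z n \<omega>) \<partial>M)"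
    by (rule nn_integral_suminf) measurable
  also have "\<dots> = (\<Sum>n. ennreal (expectation (Z n)))"
    using int nonneg by (simp add: nn_integral_eq_integral)
  also have "\<dots> \<noteq> top"
    using sum nonneg by (simp add: suminf_ennreal2)
  finally have "AE \<omega> in M. (\<Sum>n. ennreal (Z n \<omega>)) \<noteq> \<infinity>"
    by (intro nn_integral_PInf_AE) (simp_all add: infinity_ennreal_def)
  then show ?thesis
  proof eventually_elim
    case (elim \<omega>)
    then have "summable (\<lambda>n. Z n \<omega>)"
      using nonneg by (intro summable_suminf_not_top) (simp_all add: infinity_ennreal_def)
    then show ?case by (rule summable_LIMSEQ_zero)
  qed
qed

text \<open>The cubic term \<open>4 * n * d ^ 3\<close> is absorbed using
  \<open>0 \<le> 2 * d\<^sup>2 * (n - d)\<^sup>2\<close>, which turns the coefficients 6 and 1 into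
  8 and 3. The term linear in \<open>d\<close> is kept because it averages to zero for a martingale
  increment.\<close>

lemma fourth_power_add_le:
  fixes n d K :: real
  assumes "\<bar>d\<bar> \<le> K"
  shows "(n + d) ^ 4 \<le> n ^ 4 + 4 * n ^ 3 * d + 8 * K\<^sup>2 * n\<^sup>2 + 3 * K ^ 4"
proof -
  have d: "d\<^sup>2 \<le> K\<^sup>2"
    using assms power_mono[of "\<bar>d\<bar>" K 2] by simp
  have "0 \<le> 2 * d\<^sup>2 * (n - d)\<^sup>2" by simp
  then have "(n + d) ^ 4 \<le> n ^ 4 + 4 * n ^ 3 * d + 8 * d\<^sup>2 * n\<^sup>2 + 3 * (d\<^sup>2)\<^sup>2"
    by (simp add: algebra_simps power2_eq_square power3_eq_cube power4_eq_xxxx)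
  also have "\<dots> \<le> n ^ 4 + 4 * n ^ 3 * d + 8 * K\<^sup>2 * n\<^sup>2 + 3 * (K\<^sup>2)\<^sup>2"
    using d power_mono[OF d, of 2] by (intro add_mono order.refl mult_left_mono mult_right_mono) simp_all
  finally show ?thesis by simp
qed

context finite_markov_chain
begin

text \<open>Adding \<open>h (Y t)\<close> turns the sum into a martingale with bounded increments. The fourth moment is
  used because \<open>t\<^sup>2 / t\<^sup>4\<close> is summable, so that no passage to subsequences is needed.\<close>

lemma fourth_moment_bound:
  assumes f: "mean f = 0"
  defines "h \<equiv> step (poisson f)"
  shows "\<exists>K. \<forall>t\<ge>1. expectation (\<lambda>\<omega>. (csum f t \<omega> + h (Y t \<omega>)) ^ 4) \<le> K * (real t)\<^sup>2"
proof -
  define g where "g = poisson f"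
  have fh: "f y + h y = g y" if "y \<in> \<Omega>" for y
    using poisson_equation[OF that, of f] f by (simp add: h_def g_def)
  obtain B1 where B1: "1 \<le> B1" "\<And>x. x \<in> \<Omega> \<Longrightarrow> \<bar>g x\<bar> \<le> B1"
    using bounded_on_states[of g] by metis
  obtain B2 where B2: "1 \<le> B2" "\<And>x. x \<in> \<Omega> \<Longrightarrow> \<bar>h x\<bar> \<le> B2"
    using bounded_on_states[of h] by metis
  define K where "K = B1 + B2"
  \<comment> \<open>The martingale increment: since \<open>f + h = g\<close> on the states, adding
    \<open>f y\<close> and exchanging \<open>h x\<close> for \<open>h y\<close> changes the sum by
    \<open>g y - h x\<close>. Its mean under row \<open>x\<close> of \<open>P\<close> is zero
    because \<open>h = step g\<close>.\<close>
  define d where "d x y = g y - h x" for x y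
  have d: "\<bar>d x y\<bar> \<le> K" if "x \<in> \<Omega>" "y \<in> \<Omega>" for x y
    using B1(2)[OF that(2)] B2(2)[OF that(1)] unfolding K_def d_def by linarith
  have d2: "(d x y)\<^sup>2 \<le> K\<^sup>2" if "x \<in> \<Omega>" "y \<in> \<Omega>" for x y
    using d[OF that] power_mono[of "\<bar>d x y\<bar>" K 2] by simp
  have d0: "(\<Sum>y\<in>\<Omega>. P x y * d x y) = 0" if "x \<in> \<Omega>" for x
    using P_sum[OF that]
    by (simp add: d_def h_def g_def kernel_step_def[of _ _ "poisson f"] right_diff_distrib sum_subtractf flip: sum_distrib_right)
  define N where "N t \<omega> = csum f t \<omega> + h (Y t \<omega>)" for t \<omega>
  have N_Suc: "N (Suc t) \<omega> = N t \<omega> + d (Y t \<omega>) (Y (Suc t) \<omega>)" if "\<omega> \<in> space M" for t \<omega>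
    using fh[OF Y_in[OF _ that, of "Suc t"]] by (simp add: N_def csum_Suc d_def)
  have int: "integrable M (\<lambda>\<omega>. G (N t \<omega>) (Y t \<omega>))" if "t \<ge> 1" for t and G :: "real \<Rightarrow> 's \<Rightarrow> real"
    unfolding N_def by (rule integrable_csum_last[OF that, of "\<lambda>s x. G (s + h x) x"])
  have N_moment_Suc: "expectation (\<lambda>\<omega>. (N (Suc t) \<omega>) ^ p) = expectation (\<lambda>\<omega>. \<Sum>y\<in>\<Omega>. P (Y t \<omega>) y * (N t \<omega> + d (Y t \<omega>) y) ^ p)"
    if t: "t \<ge> 1" for t p
  proof -
    have "expectation (\<lambda>\<omega>. (N (Suc t) \<omega>) ^ p) = expectation (\<lambda>\<omega>. (N t \<omega> + d (Y t \<omega>) (Y (Suc t) \<omega>)) ^ p)"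
      by (intro Bochner_Integration.integral_cong refl) (simp add: N_Suc)
    then show ?thesis
      using expectation_csum_step[OF t, of "\<lambda>s x y. (s + h x + d x y) ^ p" f] by (simp add: N_def)
  qed
  have N_1: "\<bar>N 1 \<omega>\<bar> \<le> K" if "\<omega> \<in> space M" for \<omega>
    using B1(2)[OF Y_in[OF _ that, of 1]] fh[OF Y_in[OF _ that, of 1]] B2(1)
    by (simp add: N_def csum_def K_def)
  \<comment> \<open>Linear growth of the second moment controls the quadratic term in the recursion
    for the fourth moment.\<close>
  have second: "expectation (\<lambda>\<omega>. (N t \<omega>)\<^sup>2) \<le> K\<^sup>2 * t" if "t \<ge> 1" for t
    using that
  proof (induction t rule: dec_induct)
    case base
    have "(N 1 \<omega>)\<^sup>2 \<le> K\<^sup>2" if "\<omega> \<in> space M" for \<omega>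
      using power_mono[OF N_1[OF that], of 2] by simp
    then have "expectation (\<lambda>\<omega>. (N 1 \<omega>)\<^sup>2) \<le> expectation (\<lambda>_. K\<^sup>2)"
      using int[of 1 "\<lambda>s _. s\<^sup>2"] by (intro integral_mono) simp_all
    then show ?case by (simp add: prob_space)
  next
    case (step t)
    have "expectation (\<lambda>\<omega>. (N (Suc t) \<omega>)\<^sup>2) = expectation (\<lambda>\<omega>. \<Sum>y\<in>\<Omega>. P (Y t \<omega>) y * (N t \<omega> + d (Y t \<omega>) y)\<^sup>2)"
      by (rule N_moment_Suc[OF step.hyps(1)])
    also have "\<dots> \<le> expectation (\<lambda>\<omega>. (N t \<omega>)\<^sup>2 + K\<^sup>2)"
    proof (rule integral_mono)
      show "integrable M (\<lambda>\<omega>. \<Sum>y\<in>\<Omega>. P (Y t \<omega>) y * (N t \<omega> + d (Y t \<omega>) y)\<^sup>2)"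
        using int[OF step.hyps(1), of "\<lambda>s x. \<Sum>y\<in>\<Omega>. P x y * (s + d x y)\<^sup>2"] .
      show "integrable M (\<lambda>\<omega>. (N t \<omega>)\<^sup>2 + K\<^sup>2)"
        using int[OF step.hyps(1), of "\<lambda>s x. s\<^sup>2 + K\<^sup>2"] .
      fix \<omega> assume "\<omega> \<in> space M"
      then have x: "Y t \<omega> \<in> \<Omega>" using Y_in[OF step.hyps(1)] by simp
      let ?x = "Y t \<omega>" and ?n = "N t \<omega>"
      have "(\<Sum>y\<in>\<Omega>. P ?x y * (?n + d ?x y)\<^sup>2) \<le> (\<Sum>y\<in>\<Omega>. P ?x y * (?n\<^sup>2 + K\<^sup>2) + 2 * ?n * (P ?x y * d ?x y))"
      proof (rule sum_mono)
        fix y assume y: "y \<in> \<Omega>"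
        have "(?n + d ?x y)\<^sup>2 \<le> ?n\<^sup>2 + K\<^sup>2 + 2 * ?n * d ?x y"
          using d2[OF x y] by (simp add: power2_sum)
        then have "P ?x y * (?n + d ?x y)\<^sup>2 \<le> P ?x y * (?n\<^sup>2 + K\<^sup>2 + 2 * ?n * d ?x y)"
          using P_nonneg[OF x y] by (rule mult_left_mono)
        then show "P ?x y * (?n + d ?x y)\<^sup>2 \<le> P ?x y * (?n\<^sup>2 + K\<^sup>2) + 2 * ?n * (P ?x y * d ?x y)"
          by (simp add: algebra_simps)
      qed
      also have "\<dots> = ?n\<^sup>2 + K\<^sup>2"
        using P_sum[OF x] d0[OF x] by (simp add: sum.distrib flip: sum_distrib_left sum_distrib_right)
      finally show "(\<Sum>y\<in>\<Omega>. P ?x y * (?n + d ?x y)\<^sup>2) \<le> ?n\<^sup>2 + K\<^sup>2" .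
    qed
    also have "\<dots> = expectation (\<lambda>\<omega>. (N t \<omega>)\<^sup>2) + K\<^sup>2"
      using int[OF step.hyps(1), of "\<lambda>s x. s\<^sup>2"] by (simp add: prob_space)
    also have "\<dots> \<le> K\<^sup>2 * Suc t"
      using step.IH by (simp add: algebra_simps)
    finally show ?case .
  qed
  \<comment> \<open>The increment is at most \<open>8 * K ^ 4 * t + 3 * K ^ 4\<close>, hence at most
    \<open>11 * K ^ 4 * t\<close>, and \<open>t\<^sup>2 + t\<close> is at most the square of
    \<open>Suc t\<close>.\<close>
  have fourth: "expectation (\<lambda>\<omega>. (N t \<omega>) ^ 4) \<le> 11 * K ^ 4 * (real t)\<^sup>2" if "t \<ge> 1" for t
    using that
  proof (induction t rule: dec_induct)
    case base
    have "(N 1 \<omega>) ^ 4 \<le> K ^ 4" if "\<omega> \<in> space M" for \<omega>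
      using power_mono[OF N_1[OF that], of 4] by simp
    then have "expectation (\<lambda>\<omega>. (N 1 \<omega>) ^ 4) \<le> expectation (\<lambda>_. K ^ 4)"
      using int[of 1 "\<lambda>s _. s ^ 4"] by (intro integral_mono) simp_all
    also have "\<dots> \<le> 11 * K ^ 4"
      using zero_le_power[of K 4] B1(1) B2(1) by (simp add: prob_space K_def)
    finally show ?case by simp
  next
    case (step t)
    have "expectation (\<lambda>\<omega>. (N (Suc t) \<omega>) ^ 4) = expectation (\<lambda>\<omega>. \<Sum>y\<in>\<Omega>. P (Y t \<omega>) y * (N t \<omega> + d (Y t \<omega>) y) ^ 4)"
      by (rule N_moment_Suc[OF step.hyps(1)])
    also have "\<dots> \<le> expectation (\<lambda>\<omega>. (N t \<omega>) ^ 4 + (8 * K\<^sup>2 * (N t \<omega>)\<^sup>2 + 3 * K ^ 4))"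
    proof (rule integral_mono)
      show "integrable M (\<lambda>\<omega>. \<Sum>y\<in>\<Omega>. P (Y t \<omega>) y * (N t \<omega> + d (Y t \<omega>) y) ^ 4)"
        using int[OF step.hyps(1), of "\<lambda>s x. \<Sum>y\<in>\<Omega>. P x y * (s + d x y) ^ 4"] .
      show "integrable M (\<lambda>\<omega>. (N t \<omega>) ^ 4 + (8 * K\<^sup>2 * (N t \<omega>)\<^sup>2 + 3 * K ^ 4))"
        using int[OF step.hyps(1), of "\<lambda>s x. s ^ 4 + (8 * K\<^sup>2 * s\<^sup>2 + 3 * K ^ 4)"] .
      fix \<omega> assume "\<omega> \<in> space M"
      then have x: "Y t \<omega> \<in> \<Omega>" using Y_in[OF step.hyps(1)] by simp
      let ?x = "Y t \<omega>" and ?n = "N t \<omega>"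
      let ?m = "?n ^ 4 + (8 * K\<^sup>2 * ?n\<^sup>2 + 3 * K ^ 4)"
      have "(\<Sum>y\<in>\<Omega>. P ?x y * (?n + d ?x y) ^ 4) \<le> (\<Sum>y\<in>\<Omega>. P ?x y * ?m + 4 * ?n ^ 3 * (P ?x y * d ?x y))"
      proof (rule sum_mono)
        fix y assume y: "y \<in> \<Omega>"
        have "P ?x y * (?n + d ?x y) ^ 4 \<le> P ?x y * (?m + 4 * ?n ^ 3 * d ?x y)"
          using fourth_power_add_le[OF d[OF x y], of ?n] P_nonneg[OF x y] by (intro mult_left_mono) simp_all
        then show "P ?x y * (?n + d ?x y) ^ 4 \<le> P ?x y * ?m + 4 * ?n ^ 3 * (P ?x y * d ?x y)"
          by (simp only: distrib_left mult.left_commute mult.assoc)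
      qed
      also have "\<dots> = ?m"
        using P_sum[OF x] d0[OF x]
        by (simp only: sum.distrib mult_zero_right add_0_right mult_1_left flip: sum_distrib_left sum_distrib_right)
      finally show "(\<Sum>y\<in>\<Omega>. P ?x y * (?n + d ?x y) ^ 4) \<le> ?m" .
    qed
    also have "\<dots> = expectation (\<lambda>\<omega>. (N t \<omega>) ^ 4) + (8 * K\<^sup>2 * expectation (\<lambda>\<omega>. (N t \<omega>)\<^sup>2) + 3 * K ^ 4)"
      using int[OF step.hyps(1), of "\<lambda>s x. s\<^sup>2"] int[OF step.hyps(1), of "\<lambda>s x. s ^ 4"] by (simp add: prob_space)
    also have "\<dots> \<le> 11 * K ^ 4 * (real t)\<^sup>2 + (8 * K\<^sup>2 * (K\<^sup>2 * t) + 3 * K ^ 4 * t)"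
      using step.IH second[OF step.hyps(1)] step.hyps(1)
      by (intro add_mono mult_left_mono) (simp_all add: mult_le_cancel_left1)
    also have "\<dots> = 11 * K ^ 4 * ((real t)\<^sup>2 + t)"
      by (simp add: algebra_simps power2_eq_square power4_eq_xxxx)
    also have "\<dots> \<le> 11 * K ^ 4 * (real (Suc t))\<^sup>2"
      by (intro mult_left_mono) (simp_all add: power2_eq_square algebra_simps)
    finally show ?case .
  qed
  show ?thesis
    using fourth unfolding N_def by blast
qed

text \<open>The fourth moments of the martingale divided by \<open>t\<close> are at most of order
  \<open>1 / t\<^sup>2\<close>, hence summable; the bounded correction \<open>h (Y t)\<close>
  disappears after division by \<open>t\<close>.\<close>

lemma csum_average_tendsto:
  assumes f: "mean f = 0"
  shows "AE \<omega> in M. (\<lambda>T. csum f T \<omega> / T) \<longlonglongrightarrow> 0"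
proof -
  define h where "h = step (poisson f)"
  define N where "N t \<omega> = csum f t \<omega> + h (Y t \<omega>)" for t \<omega>
  obtain K where K: "\<forall>t\<ge>1. expectation (\<lambda>\<omega>. N t \<omega> ^ 4) \<le> K * (real t)\<^sup>2"
    using fourth_moment_bound[OF f] by (auto simp: N_def h_def)
  obtain B where B: "1 \<le> B" "\<And>x. x \<in> \<Omega> \<Longrightarrow> \<bar>h x\<bar> \<le> B"
    using bounded_on_states[of h] by metis
  have int: "integrable M (\<lambda>\<omega>. (N (Suc k) \<omega> / Suc k) ^ 4)" for k
    unfolding N_def by (rule integrable_csum_last[of "Suc k" "\<lambda>s x. ((s + h x) / Suc k) ^ 4"]) simp
  have "AE \<omega> in M. (\<lambda>k. (N (Suc k) \<omega> / Suc k) ^ 4) \<longlonglongrightarrow> 0"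
  proof (rule AE_tendsto_zero_if_summable_expectation[OF int])
    show "summable (\<lambda>k. expectation (\<lambda>\<omega>. (N (Suc k) \<omega> / Suc k) ^ 4))"
    proof (rule summable_comparison_test')
      have "summable (\<lambda>k. inverse (real (Suc k) ^ 2))"
        using inverse_power_summable[of 2] summable_Suc_iff[of "\<lambda>k. inverse (real k ^ 2)"] by simp
      then show "summable (\<lambda>k. K * inverse (real (Suc k) ^ 2))"
        by (rule summable_mult)
      show "norm (expectation (\<lambda>\<omega>. (N (Suc k) \<omega> / Suc k) ^ 4)) \<le> K * inverse (real (Suc k) ^ 2)" if "k \<ge> 0" for k
      proof -
        have "expectation (\<lambda>\<omega>. (N (Suc k) \<omega> / Suc k) ^ 4) = expectation (\<lambda>\<omega>. N (Suc k) \<omega> ^ 4) / real (Suc k) ^ 4"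
          by (simp add: power_divide del: of_nat_Suc)
        also have "\<dots> \<le> K * (real (Suc k))\<^sup>2 / real (Suc k) ^ 4"
          using K[rule_format, of "Suc k"] by (intro divide_right_mono) (simp_all del: of_nat_Suc)
        also have "\<dots> = K * inverse (real (Suc k) ^ 2)"
          by (simp add: field_simps power2_eq_square power4_eq_xxxx del: of_nat_Suc)
        finally show ?thesis
          by (simp add: integral_nonneg_AE del: of_nat_Suc)
      qed
    qed
  qed simp
  then have "AE \<omega> in M. \<omega> \<in> space M \<and> (\<lambda>k. (N (Suc k) \<omega> / Suc k) ^ 4) \<longlonglongrightarrow> 0"
    by (simp add: AE_space)
  then show ?thesis
  proof eventually_elim
    case (elim \<omega>)
    \<comment> \<open>Taking fourth roots recovers the absolute value of the average itself.\<close>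
    then have "(\<lambda>k. root 4 ((N (Suc k) \<omega> / Suc k) ^ 4)) \<longlonglongrightarrow> root 4 0"
      by (intro tendsto_real_root) auto
    moreover have "root 4 ((N (Suc k) \<omega> / Suc k) ^ 4) = \<bar>N (Suc k) \<omega> / Suc k\<bar>" for k
      using real_root_power_cancel[of 4 "\<bar>N (Suc k) \<omega> / Suc k\<bar>"] by (simp only: power_even_abs_numeral even_numeral)
    ultimately have 1: "(\<lambda>k. N (Suc k) \<omega> / Suc k) \<longlonglongrightarrow> 0"
      by (simp only: real_root_zero tendsto_rabs_zero_iff)
    have 2: "(\<lambda>k. h (Y (Suc k) \<omega>) / Suc k) \<longlonglongrightarrow> 0"
    proof (rule Lim_null_comparison)
      show "(\<lambda>k. B / Suc k) \<longlonglongrightarrow> 0"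
        by real_asymp
      show "\<forall>\<^sub>F k in sequentially. norm (h (Y (Suc k) \<omega>) / Suc k) \<le> B / Suc k"
        using B(2)[OF Y_in] elim by (intro always_eventually allI) (simp add: abs_divide divide_right_mono)
    qed
    have "(\<lambda>k. csum f (Suc k) \<omega> / Suc k) \<longlonglongrightarrow> 0"
      using tendsto_diff[OF 1 2] by (simp add: N_def diff_divide_distrib[symmetric])
    then show ?case
      by (rule LIMSEQ_imp_Suc[where f = "\<lambda>T. csum f T \<omega> / real T"])
  qed
qed

lemma mean_centered: "mean (\<lambda>x. f x - mean f) = 0"
proof -
  have "mean (\<lambda>x. f x - c) = mean f - c" for c
    using \<mu>_sum by (simp add: mean_def right_diff_distrib sum_subtractf flip: sum_distrib_right)
  then show ?thesis by simp
qed

lemma csum_centered: "csum (\<lambda>x. f x - c) T \<omega> = (\<Sum>t=1..T. f (Y t \<omega>)) - T * c"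
  by (simp add: csum_def sum_subtractf)

lemma has_temporal_mean_function: "has_temporal_mean M (\<lambda>t \<omega>. f (Y t \<omega>)) (mean f)"
  unfolding has_temporal_mean_def
  using csum_average_tendsto[OF mean_centered[of f]]
proof eventually_elim
  case (elim \<omega>)
  then have "(\<lambda>T. csum (\<lambda>x. f x - mean f) T \<omega> / T + mean f) \<longlonglongrightarrow> 0 + mean f"
    by (intro tendsto_intros)
  \<comment> \<open>The two sides may differ at \<open>T = 0\<close>, where division by zero yields
    0.\<close>
  moreover have "\<forall>\<^sub>F T in sequentially. csum (\<lambda>x. f x - mean f) T \<omega> / T + mean f = (\<Sum>t=1..T. f (Y t \<omega>)) / T"
    using eventually_gt_at_top[of 0] by eventually_elim (simp add: csum_centered field_simps)
  ultimately show ?case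
    by (simp add: Lim_transform_eventually)
qed

text \<open>Otherwise the limit of the characteristic functions would exceed 1.\<close>

lemma asymptotic_variance_nonneg:
  assumes "mean f = 0"
  shows "0 \<le> asymptotic_variance f"
proof -
  have "(\<lambda>n. cmod (expectation (\<lambda>\<omega>. iexp (1 / sqrt n * csum f n \<omega>)))) \<longlonglongrightarrow>
      cmod (complex_of_real (exp (- (1\<^sup>2 * asymptotic_variance f / 2))))"
    by (intro tendsto_norm csum_char_tendsto[OF assms])
  moreover have "cmod (expectation (\<lambda>\<omega>. iexp (1 / sqrt n * csum f n \<omega>))) \<le> 1" for n
    using integrable_csum[of "\<lambda>s. iexp (1 / sqrt n * s)" f n] by (intro norm_expectation_le) simp_all
  ultimately have "cmod (complex_of_real (exp (- (1\<^sup>2 * asymptotic_variance f / 2)))) \<le> 1"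
    by (intro LIMSEQ_le_const2) auto
  then show ?thesis by simp
qed

lemma has_temporal_variance_function:
  "has_temporal_variance M (\<lambda>t \<omega>. f (Y t \<omega>)) (mean f) (asymptotic_variance (\<lambda>x. f x - mean f))"
proof -
  define f0 where "f0 = (\<lambda>x. f x - mean f)"
  define \<sigma> where "\<sigma> = sqrt (asymptotic_variance f0)"
  have mean0: "mean f0 = 0"
    unfolding f0_def by (rule mean_centered)
  have \<sigma>2: "\<sigma>\<^sup>2 = asymptotic_variance f0"
    using asymptotic_variance_nonneg[OF mean0] by (simp add: \<sigma>_def)
  \<comment> \<open>Scaling a standard normal variable, instead of using a normal density of
    variance \<open>\<sigma>\<^sup>2\<close>, also covers \<open>\<sigma> = 0\<close>, where the
    limit law is a point mass at 0.\<close>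
  define L where "L = distr std_normal_distribution borel (\<lambda>x. \<sigma> * x)"
  interpret std: real_distribution std_normal_distribution
    by (rule real_dist_normal_dist)
  have L: "real_distribution L"
    unfolding L_def by (rule std.real_distribution_distr) measurable
  have sum_eq: "((\<Sum>t=1..T. f (Y t \<omega>)) - real T * mean f) / sqrt T = csum f0 T \<omega> / sqrt T" for T \<omega>
    by (simp add: f0_def csum_centered)
  have meas: "(\<lambda>\<omega>. csum f0 T \<omega> / sqrt T) \<in> borel_measurable M" for T
    using integrable_csum[of "\<lambda>s. s / sqrt T"] by (rule borel_measurable_integrable)
  have "weak_conv_m (\<lambda>T. distr M borel (\<lambda>\<omega>. csum f0 T \<omega> / sqrt T)) L"
  proof (rule levy_continuity)
    show "real_distribution (distr M borel (\<lambda>\<omega>. csum f0 T \<omega> / sqrt T))" for T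
      by (rule real_distribution_distr) (rule meas)
    show "real_distribution L" by (rule L)
    fix u
    have "char (distr M borel (\<lambda>\<omega>. csum f0 T \<omega> / sqrt T)) u = expectation (\<lambda>\<omega>. iexp (u / sqrt T * csum f0 T \<omega>))" for T
      unfolding char_def by (subst integral_distr[OF meas]) simp_all
    moreover have "char L u = complex_of_real (exp (- (u\<^sup>2 * asymptotic_variance f0 / 2)))"
    proof -
      have "char L u = char std_normal_distribution (u * \<sigma>)"
        unfolding char_def L_def by (subst integral_distr) (simp_all add: mult_ac)
      then show ?thesis
        by (simp add: char_std_normal_distribution power_mult_distrib \<sigma>2)
    qed
    ultimately show "(\<lambda>T. char (distr M borel (\<lambda>\<omega>. csum f0 T \<omega> / sqrt T)) u) \<longlonglongrightarrow> char L u"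
      using csum_char_tendsto[OF mean0, of u] by simp
  qed
  moreover have "integrable L (\<lambda>x. x\<^sup>2)"
  proof -
    have "integrable std_normal_distribution (\<lambda>x. \<sigma>\<^sup>2 * x\<^sup>2)"
      by (intro integrable_mult_right integrable_std_normal_distribution_moment)
    then show ?thesis
      unfolding L_def by (subst integrable_distr_eq) (simp_all add: power_mult_distrib)
  qed
  moreover have "(LINT x|L. x\<^sup>2) = asymptotic_variance f0"
    unfolding L_def using std_normal_distribution_even_moments(1)[of 1]
    by (subst integral_distr) (simp_all add: power_mult_distrib \<sigma>2)
  ultimately show ?thesis
    unfolding has_temporal_variance_def sum_eq f0_def[symmetric] using L by blast
qed

text \<open>For the centred indicator \<open>f\<close> of \<open>w\<close>, the stationary mean of
  \<open>f * g\<close> is \<open>\<mu> w * (g w - mean g)\<close>. With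
  \<open>g = step (poisson f)\<close>, which has mean zero, only the value at \<open>w\<close>
  survives, and that is the series of centred return probabilities.\<close>

lemma sums_asymptotic_variance_state:
  assumes w: "w \<in> \<Omega>"
  shows "(\<lambda>k. ((step ^^ Suc k) (\<lambda>x. of_bool (x = w)) w - \<mu> w) * \<mu> w) sums
    ((asymptotic_variance (\<lambda>x. of_bool (x = w) - \<mu> w) - \<mu> w + (\<mu> w)\<^sup>2) / 2)"
proof -
  let ?e = "\<lambda>x. of_bool (x = w) :: real"
  define f where "f = (\<lambda>x. ?e x - \<mu> w)"
  have mean_e: "mean (\<lambda>x. ?e x * g x) = \<mu> w * g w" for g
    using finite_states w by (simp add: mean_def of_bool_def if_distrib if_distribR cong: if_cong)
  have meanf: "mean (\<lambda>x. f x * g x) = \<mu> w * (g w - mean g)" for g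
    using mean_e[of g] by (simp add: f_def mean_def algebra_simps sum_subtractf sum_distrib_left)
  have mean_e1: "mean ?e = \<mu> w"
    using mean_e[of "\<lambda>_. 1"] by simp
  have "mean f = 0"
    using mean_centered[of ?e] by (simp add: f_def mean_e1)
  have mean_step: "mean (step g) = mean g" for g
  proof -
    have "mean (step g) = (\<Sum>y\<in>\<Omega>. (\<Sum>x\<in>\<Omega>. \<mu> x * P x y) * g y)"
      unfolding mean_def kernel_step_def sum_distrib_left sum_distrib_right mult.assoc by (rule sum.swap)
    then show ?thesis
      by (simp add: \<mu>_stationary mean_def)
  qed
  \<comment> \<open>Constants are fixed by \<open>step\<close>, so centring commutes with its
    powers.\<close>
  have step_f: "(step ^^ k) f x = (step ^^ k) ?e x - \<mu> w" if "x \<in> \<Omega>" for k x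
  proof -
    have one: "(step ^^ k) (\<lambda>_. c) x = c" if "x \<in> \<Omega>" for x c k
      using that
    proof (induction k arbitrary: x)
      case (Suc k)
      then show ?case
        using P_sum[OF Suc.prems] by (simp add: kernel_step_def[of _ _ "(step ^^ k) _"] flip: sum_distrib_right)
    qed simp
    have "(step ^^ k) f x = (step ^^ k) ?e x - (step ^^ k) (\<lambda>_. \<mu> w) x"
      unfolding step_pow_expand[OF that, of k f] step_pow_expand[OF that, of k ?e] step_pow_expand[OF that, of k "\<lambda>_. \<mu> w"]
      by (simp add: f_def left_diff_distrib sum_subtractf)
    then show ?thesis
      using one[OF that] by simp
  qed
  have sums: "(\<lambda>k. (step ^^ Suc k) f x) sums step (poisson f) x" if "x \<in> \<Omega>" for x
    using step_poisson_sums[OF that, of f] \<open>mean f = 0\<close> by simp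
  \<comment> \<open>Stationarity makes every term of the series for \<open>poisson f\<close>
    centred.\<close>
  have "mean (poisson f) = 0"
  proof -
    have "(\<lambda>k. \<Sum>x\<in>\<Omega>. \<mu> x * ((step ^^ k) f x - mean f)) sums (\<Sum>x\<in>\<Omega>. \<mu> x * poisson f x)"
      unfolding poisson_def by (intro sums_sum sums_mult summable_sums summable_step_pow)
    moreover have "(\<Sum>x\<in>\<Omega>. \<mu> x * ((step ^^ k) f x - mean f)) = 0" for k
    proof -
      have "mean ((step ^^ k) f) = 0"
        by (induction k) (simp_all add: \<open>mean f = 0\<close> mean_step)
      then show ?thesis
        by (simp add: \<open>mean f = 0\<close>) (simp add: mean_def)
    qed
    ultimately have "(\<lambda>k. 0) sums mean (poisson f)"
      by (simp add: mean_def[of "poisson f"])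
    then show ?thesis
      using sums_unique2 sums_zero by blast
  qed
  then have "mean (\<lambda>x. f x * step (poisson f) x) = \<mu> w * step (poisson f) w"
    by (simp add: meanf mean_step)
  moreover have "mean (\<lambda>x. (f x)\<^sup>2) = \<mu> w - (\<mu> w)\<^sup>2"
    using meanf[of f] \<open>mean f = 0\<close> by (simp add: power2_eq_square f_def right_diff_distrib)
  ultimately have "asymptotic_variance f = \<mu> w - (\<mu> w)\<^sup>2 + 2 * (\<mu> w * step (poisson f) w)"
    by (simp add: asymptotic_variance_def)
  then have "(asymptotic_variance f - \<mu> w + (\<mu> w)\<^sup>2) / 2 = step (poisson f) w * \<mu> w"
    by simp
  moreover have "(\<lambda>k. (step ^^ Suc k) f w * \<mu> w) sums (step (poisson f) w * \<mu> w)"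
    using sums[OF w] by (rule sums_mult2)
  ultimately show ?thesis
    using step_f[OF w, of "Suc _"] by (simp only: f_def[symmetric])
qed

end

subsection \<open>The joint chain of independent two-state users\<close>

lemma UNIV_mode: "(UNIV :: mode set) = {TX, Idle}"
  using mode.exhaust by auto

lemma finite_UNIV_mode: "finite (UNIV :: mode set)"
  by (simp add: UNIV_mode)

text \<open>Distributivity of products over sums. Every claim about the joint chain is reduced to a
  single user through this factorisation.\<close>

lemma sum_configs_prod:
  fixes g :: "'u \<Rightarrow> mode \<Rightarrow> real"
  assumes "finite U"
  shows "(\<Sum>x\<in>PiE U (\<lambda>_. UNIV). \<Prod>u\<in>U. g u (x u)) = (\<Prod>u\<in>U. \<Sum>z\<in>UNIV. g u z)"
  using prod_sum_PiE[OF assms finite_UNIV_mode, of g] by simp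

lemma trans_prob_sum: "(\<Sum>y\<in>UNIV. trans_prob r s x y) = 1"
  by (cases x) (simp_all add: UNIV_mode)

section \<open>The two-state chain: stationary law and powers of the transition matrix\<close>

definition stationary :: "real \<Rightarrow> mode \<Rightarrow> real" where
  "stationary lam z = (if z = TX then lam else 1 - lam)"

text \<open>The spectral form of the \<open>k\<close>-th power of the transition matrix, whose
  eigenvalues are 1 and \<open>theta\<close>. For \<open>k = 0\<close> it is the identity, also when
  \<open>theta = 0\<close>.\<close>

definition trans_power :: "real \<Rightarrow> real \<Rightarrow> nat \<Rightarrow> mode \<Rightarrow> mode \<Rightarrow> real" where
  "trans_power lam theta k x y = stationary lam y + theta ^ k * (of_bool (x = y) - stationary lam y)"

lemma stationary_sum: "(\<Sum>x\<in>UNIV. stationary lam x) = 1"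
  by (simp add: UNIV_mode stationary_def)

context
  fixes r s lam theta :: real
  assumes r: "r \<in> {0..1}" and s: "s \<in> {0..1}" and rs: "0 < r + s" "r + s < 2"
    and lam: "lam = r / (r + s)" and theta: "theta = 1 - r - s"
begin

lemma lam_bounds: "0 \<le> lam" "lam \<le> 1"
  using r s rs by (auto simp: lam)

lemma theta_bound: "\<bar>theta\<bar> < 1"
  using rs by (simp add: theta)

lemma lam_eq: "lam * (1 - theta) = r" "(1 - lam) * (1 - theta) = s"
  using rs by (simp_all add: lam theta field_simps)

lemma trans_prob_eq: "trans_prob r s x y = trans_power lam theta 1 x y"
proof -
  have "r = lam - lam * theta" "s = 1 - lam - (1 - lam) * theta"
    using lam_eq by (simp_all add: algebra_simps)
  then show ?thesis
    by (cases x; cases y) (simp_all add: trans_power_def stationary_def algebra_simps)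
qed

lemma trans_prob_nonneg: "0 \<le> trans_prob r s x y"
  using r s by (cases x; cases y) auto

lemma stationary_nonneg: "0 \<le> stationary lam x"
  using lam_bounds by (simp add: stationary_def)

lemma stationary_le_1: "stationary lam x \<le> 1"
  using lam_bounds by (simp add: stationary_def)

lemma stationary_trans_prob: "(\<Sum>x\<in>UNIV. stationary lam x * trans_prob r s x y) = stationary lam y"
  unfolding trans_prob_eq
  by (cases y) (simp_all add: UNIV_mode stationary_def trans_power_def algebra_simps)

lemma trans_power_Suc: "(\<Sum>z\<in>UNIV. trans_prob r s x z * trans_power lam theta k z y) = trans_power lam theta (Suc k) x y"
  unfolding trans_prob_eq
  by (cases x; cases y) (simp_all add: UNIV_mode stationary_def trans_power_def algebra_simps)

text \<open>The closed form hides the sign when \<open>theta\<close> is negative. Inductively,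
  though, each power is an average of entries of the previous one, so the values stay in the unit
  interval.\<close>

lemma trans_power_bounds: "0 \<le> trans_power lam theta k x y \<and> trans_power lam theta k x y \<le> 1"
proof (induction k arbitrary: x)
  case (Suc k)
  have "0 \<le> (\<Sum>z\<in>UNIV. trans_prob r s x z * trans_power lam theta k z y)"
    using Suc trans_prob_nonneg by (intro sum_nonneg mult_nonneg_nonneg) auto
  moreover have "(\<Sum>z\<in>UNIV. trans_prob r s x z * trans_power lam theta k z y) \<le> (\<Sum>z\<in>UNIV. trans_prob r s x z * 1)"
    using Suc trans_prob_nonneg by (intro sum_mono mult_left_mono) auto
  ultimately show ?case
    using trans_prob_sum[of r s x] by (simp add: trans_power_Suc)
qed (simp add: trans_power_def)

lemma trans_power_bound: "\<bar>trans_power lam theta k x y - stationary lam y\<bar> \<le> \<bar>theta\<bar> ^ k"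
proof -
  have "\<bar>trans_power lam theta k x y - stationary lam y\<bar> = \<bar>theta\<bar> ^ k * \<bar>of_bool (x = y) - stationary lam y\<bar>"
    by (simp add: trans_power_def abs_mult power_abs)
  also have "\<dots> \<le> \<bar>theta\<bar> ^ k * 1"
    using stationary_nonneg[of y] stationary_le_1[of y] by (intro mult_left_mono) (auto simp: of_bool_def)
  finally show ?thesis by simp
qed

context
  fixes U :: "'u set"
  assumes U: "finite U"
begin

abbreviation configs :: "('u \<Rightarrow> mode) set" where
  "configs \<equiv> PiE U (\<lambda>_. UNIV)"

abbreviation prod_trans :: "('u \<Rightarrow> mode) \<Rightarrow> ('u \<Rightarrow> mode) \<Rightarrow> real" where
  "prod_trans x y \<equiv> \<Prod>u\<in>U. trans_prob r s (x u) (y u)"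

text \<open>Users move independently, so the sum over intermediate configurations factors into one
  Chapman-Kolmogorov sum per user. At \<open>k = 0\<close> equality of configurations is equality at
  every user in \<open>U\<close>.\<close>

lemma kernel_step_power_prod:
  assumes "w \<in> configs" "x \<in> configs"
  shows "(kernel_step configs prod_trans ^^ k) (\<lambda>x. of_bool (x = w)) x = (\<Prod>u\<in>U. trans_power lam theta k (x u) (w u))"
  using assms(2)
proof (induction k arbitrary: x)
  case 0
  have "x = w \<longleftrightarrow> (\<forall>u\<in>U. x u = w u)"
    using 0 assms(1) by (auto intro: PiE_ext)
  then have "of_bool (x = w) = (\<Prod>u\<in>U. of_bool (x u = w u) :: real)"
    using U by (auto simp: of_bool_def)
  then show ?case
    by (simp add: trans_power_def)
next
  case (Suc k)
  have "(kernel_step configs prod_trans ^^ Suc k) (\<lambda>x. of_bool (x = w)) x =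
      (\<Sum>z\<in>configs. \<Prod>u\<in>U. trans_prob r s (x u) (z u) * trans_power lam theta k (z u) (w u))"
    using Suc.IH by (simp add: kernel_step_def[of _ _ "(kernel_step _ _ ^^ k) _"] prod.distrib)
  then show ?case
    by (simp add: sum_configs_prod[OF U, of "\<lambda>u z. trans_prob r s (x u) z * trans_power lam theta k z (w u)"] trans_power_Suc)
qed

text \<open>A difference of products of numbers in the unit interval is at most the sum of the
  differences of the factors, each of which is at most \<open>\<bar>theta\<bar> ^ k\<close>.\<close>

lemma prod_trans_geometric:
  assumes "w \<in> configs" "x \<in> configs"
  shows "\<bar>(kernel_step configs prod_trans ^^ k) (\<lambda>x. of_bool (x = w)) x - (\<Prod>u\<in>U. stationary lam (w u))\<bar>
    \<le> card U * \<bar>theta\<bar> ^ k"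
proof -
  have "norm ((\<Prod>u\<in>U. trans_power lam theta k (x u) (w u)) - (\<Prod>u\<in>U. stationary lam (w u))) \<le>
      (\<Sum>u\<in>U. norm (trans_power lam theta k (x u) (w u) - stationary lam (w u)))"
    using trans_power_bounds stationary_nonneg stationary_le_1 by (intro norm_prod_diff) auto
  also have "\<dots> \<le> (\<Sum>u\<in>U. \<bar>theta\<bar> ^ k)"
    using trans_power_bound by (intro sum_mono) simp
  finally show ?thesis
    by (simp add: kernel_step_power_prod[OF assms])
qed

end

end

section \<open>From independent trajectories to the joint Markov chain\<close>

lemma two_state_markov_path_prob:
  assumes "prob_space M" "two_state_markov M r s Z" "t \<ge> 1"
  shows "\<P>(\<omega> in M. \<forall>i\<in>{1..Suc t}. Z i \<omega> = z i) =
    \<P>(\<omega> in M. \<forall>i\<in>{1..t}. Z i \<omega> = z i) * trans_prob r s (z t) (z (Suc t))"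
proof -
  interpret prob_space M by fact
  have meas: "Z i \<in> measurable M (count_space UNIV)" if "i \<ge> 1" for i
    using assms(2) that by (simp add: two_state_markov_def)
  have ev: "{\<omega> \<in> space M. \<forall>i\<in>{1..k}. Z i \<omega> = z i} \<in> events" for k
    using meas by (intro sets.sets_Collect_finite_All) auto
  show ?thesis
  proof (cases "\<P>(\<omega> in M. \<forall>i\<in>{1..t}. Z i \<omega> = z i) > 0")
    case True
    then have "\<P>(\<omega> in M. Z (Suc t) \<omega> = z (Suc t) \<bar> \<forall>i\<in>{1..t}. Z i \<omega> = z i) = trans_prob r s (z t) (z (Suc t))"
      using assms(2,3) by (simp add: two_state_markov_def)
    moreover have "(Z (Suc t) \<omega> = z (Suc t) \<and> (\<forall>i\<in>{1..t}. Z i \<omega> = z i)) \<longleftrightarrow> (\<forall>i\<in>{1..Suc t}. Z i \<omega> = z i)" for \<omega>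
      by (auto simp: atLeastAtMostSuc_conv)
    ultimately show ?thesis
      using True by (simp add: cond_prob_def field_simps)
  \<comment> \<open>The Markov property says nothing about a past of probability zero; there both
    sides vanish.\<close>
  next
    case False
    moreover have "\<P>(\<omega> in M. \<forall>i\<in>{1..Suc t}. Z i \<omega> = z i) \<le> \<P>(\<omega> in M. \<forall>i\<in>{1..t}. Z i \<omega> = z i)"
      by (intro finite_measure_mono ev) auto
    moreover have "\<P>(\<omega> in M. \<forall>i\<in>{1..t}. Z i \<omega> = z i) = 0"
      using False by (simp only: zero_less_measure_iff not_not)
    ultimately show ?thesis
      by (simp only: measure_le_0_iff mult_zero_left)
  qed
qed

text \<open>Exchanging the quantifiers over slots and users writes the joint path event as an
  intersection of one event per user, to which independence of the trajectories applies. The value 0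
  covers paths that no restricted configuration can follow.\<close>

lemma independent_users_path_prob:
  assumes "prob_space M" "independent_two_state_users M C N r s X" "finite U" "U \<noteq> {}" "U \<subseteq> users C N"
  shows "\<P>(\<omega> in M. \<forall>i\<in>{1..t}. (\<lambda>u\<in>U. X u i \<omega>) = y i) =
    (if \<forall>i\<in>{1..t}. y i \<in> extensional U then \<Prod>u\<in>U. \<P>(\<omega> in M. \<forall>i\<in>{1..t}. X u i \<omega> = y i u) else 0)"
proof (cases "\<forall>i\<in>{1..t}. y i \<in> extensional U")
  case True
  interpret prob_space M by fact
  define T where "T u \<omega> = (\<lambda>i\<in>{1::nat..}. X u i \<omega>)" for u \<omega>
  \<comment> \<open>A cylinder set in the space of trajectories; it constrains finitely many
    coordinates and is therefore measurable.\<close>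
  define E where "E u = {x \<in> space (\<Pi>\<^sub>M i\<in>{1::nat..}. count_space (UNIV :: mode set)). \<forall>i\<in>{1..t}. x i = y i u}" for u
  have E: "E u \<in> sets (\<Pi>\<^sub>M i\<in>{1::nat..}. count_space UNIV)" for u
    unfolding E_def
  proof (intro sets.sets_Collect_finite_All)
    fix i assume "i \<in> {1..t}"
    then have [measurable]: "(\<lambda>x. x i) \<in> measurable (\<Pi>\<^sub>M i\<in>{1::nat..}. count_space (UNIV :: mode set)) (count_space UNIV)"
      by (intro measurable_component_singleton) simp
    show "{x \<in> space (\<Pi>\<^sub>M i\<in>{1::nat..}. count_space UNIV). x i = y i u} \<in> sets (\<Pi>\<^sub>M i\<in>{1::nat..}. count_space UNIV)"
      by measurable
  qed simp
  have pre: "T u -` E u \<inter> space M = {\<omega> \<in> space M. \<forall>i\<in>{1..t}. X u i \<omega> = y i u}" for u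
    by (auto simp: T_def E_def space_PiM)
  have "indep_vars (\<lambda>_. \<Pi>\<^sub>M i\<in>{1::nat..}. count_space UNIV) T (users C N)"
    using assms(2) unfolding independent_two_state_users_def T_def by simp
  then have "prob (\<Inter>u\<in>U. T u -` E u \<inter> space M) = (\<Prod>u\<in>U. prob (T u -` E u \<inter> space M))"
    using assms E by (intro indep_varsD) auto
  moreover have "(\<Inter>u\<in>U. T u -` E u \<inter> space M) = {\<omega> \<in> space M. \<forall>i\<in>{1..t}. (\<lambda>u\<in>U. X u i \<omega>) = y i}"
    unfolding pre using True \<open>U \<noteq> {}\<close> by (auto simp: fun_eq_iff extensional_def restrict_def)
  ultimately show ?thesis
    using True by (simp add: pre)
next
  case False
  then have "{\<omega> \<in> space M. \<forall>i\<in>{1..t}. (\<lambda>u\<in>U. X u i \<omega>) = y i} = {}"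
    by (metis (mono_tags, lifting) Collect_empty_eq restrict_extensional)
  then show ?thesis
    by (simp only: False if_False measure_empty)
qed

text \<open>Path probabilities factor over the users by independence, and each factor is extended by
  one slot using that user's Markov property. The set \<open>U\<close> is kept general: one cluster
  serves for delivery, all users for passive detection.\<close>

lemma product_markov_chain:
  fixes r s lam theta :: real and X :: "nat \<times> nat \<Rightarrow> nat \<Rightarrow> 'a \<Rightarrow> mode"
  assumes "prob_space M" "r \<in> {0..1}" "s \<in> {0..1}" "0 < r + s" "r + s < 2"
    and "lam = r / (r + s)" "theta = 1 - r - s"
    and X: "independent_two_state_users M C N r s X" and U: "finite U" "U \<noteq> {}" "U \<subseteq> users C N"
  shows "finite_markov_chain M (\<lambda>t \<omega>. \<lambda>u\<in>U. X u t \<omega>) (PiE U (\<lambda>_. UNIV))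
    (\<lambda>x y. \<Prod>u\<in>U. trans_prob r s (x u) (y u)) (\<lambda>x. \<Prod>u\<in>U. stationary lam (x u))"
proof -
  interpret prob_space M by fact
  note * = assms(2-7)
  have markov: "two_state_markov M r s (X u)" if "u \<in> U" for u
    using X U that by (auto simp: independent_two_state_users_def)
  show ?thesis
  proof
    show "finite (PiE U (\<lambda>_. UNIV :: mode set))"
      using U finite_UNIV_mode by (intro finite_PiE) auto
    show "(\<lambda>\<omega>. \<lambda>u\<in>U. X u t \<omega>) \<in> measurable M (count_space (PiE U (\<lambda>_. UNIV)))" if "t \<ge> 1" for t
    proof (subst measurable_count_space_eq2)
      show "finite (PiE U (\<lambda>_. UNIV :: mode set))"
        using U finite_UNIV_mode by (intro finite_PiE) auto
      have "(\<lambda>\<omega>. \<lambda>u\<in>U. X u t \<omega>) -` {w} \<inter> space M \<in> events" if w: "w \<in> PiE U (\<lambda>_. UNIV)" for w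
      proof -
        have "(\<lambda>\<omega>. \<lambda>u\<in>U. X u t \<omega>) -` {w} \<inter> space M = {\<omega> \<in> space M. \<forall>u\<in>U. X u t \<omega> = w u}"
          using w by (auto simp: fun_eq_iff PiE_def extensional_def restrict_def)
        also have "\<dots> \<in> events"
        proof (intro sets.sets_Collect_finite_All)
          fix u assume "u \<in> U"
          then have "X u t \<in> measurable M (count_space UNIV)"
            using markov \<open>t \<ge> 1\<close> by (simp add: two_state_markov_def)
          then show "{\<omega> \<in> space M. X u t \<omega> = w u} \<in> events"
            by auto
        qed (rule U(1))
        finally show ?thesis .
      qed
      then show "(\<lambda>\<omega>. \<lambda>u\<in>U. X u t \<omega>) \<in> space M \<rightarrow> PiE U (\<lambda>_. UNIV) \<and>
          (\<forall>w\<in>PiE U (\<lambda>_. UNIV). (\<lambda>\<omega>. \<lambda>u\<in>U. X u t \<omega>) -` {w} \<inter> space M \<in> events)"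
        by auto
    qed
    show "(\<Prod>u\<in>U. trans_prob r s (x u) (y u)) \<ge> 0" for x y
      using trans_prob_nonneg[OF *] by (intro prod_nonneg) auto
    show "(\<Sum>y\<in>PiE U (\<lambda>_. UNIV). \<Prod>u\<in>U. trans_prob r s (x u) (y u)) = 1" for x
      using sum_configs_prod[OF U(1), of "\<lambda>u z. trans_prob r s (x u) z"] trans_prob_sum by simp
    show "(\<Sum>x\<in>PiE U (\<lambda>_. UNIV). \<Prod>u\<in>U. stationary lam (x u)) = 1"
      using sum_configs_prod[OF U(1), of "\<lambda>u z. stationary lam z"] stationary_sum by simp
    show "(\<Sum>x\<in>PiE U (\<lambda>_. UNIV). (\<Prod>u\<in>U. stationary lam (x u)) * (\<Prod>u\<in>U. trans_prob r s (x u) (y u))) =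
        (\<Prod>u\<in>U. stationary lam (y u))" for y
      using sum_configs_prod[OF U(1), of "\<lambda>u z. stationary lam z * trans_prob r s z (y u)"] stationary_trans_prob[OF *]
      by (simp add: prod.distrib)
    show "\<exists>B c. 0 \<le> c \<and> c < 1 \<and> (\<forall>k. \<forall>x\<in>PiE U (\<lambda>_. UNIV). \<forall>y\<in>PiE U (\<lambda>_. UNIV).
        \<bar>(kernel_step (PiE U (\<lambda>_. UNIV)) (\<lambda>x y. \<Prod>u\<in>U. trans_prob r s (x u) (y u)) ^^ k) (\<lambda>x. of_bool (x = y)) x
          - (\<Prod>u\<in>U. stationary lam (y u))\<bar> \<le> B * c ^ k)"
      using prod_trans_geometric[OF * U(1)] theta_bound[OF *]
      by (intro exI[of _ "real (card U)"] exI[of _ "\<bar>theta\<bar>"]) auto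
    show "\<P>(\<omega> in M. \<forall>i\<in>{1..Suc t}. (\<lambda>u\<in>U. X u i \<omega>) = y i) =
        \<P>(\<omega> in M. \<forall>i\<in>{1..t}. (\<lambda>u\<in>U. X u i \<omega>) = y i) * (\<Prod>u\<in>U. trans_prob r s (y t u) (y (Suc t) u))"
      if t: "t \<ge> 1" and y: "\<And>i. i \<in> {1..Suc t} \<Longrightarrow> y i \<in> PiE U (\<lambda>_. UNIV)" for t y
    proof -
      have ext: "\<forall>i\<in>{1..Suc t}. y i \<in> extensional U" "\<forall>i\<in>{1..t}. y i \<in> extensional U"
        using y by (auto simp: PiE_def)
      have "(\<Prod>u\<in>U. \<P>(\<omega> in M. \<forall>i\<in>{1..Suc t}. X u i \<omega> = y i u)) =
          (\<Prod>u\<in>U. \<P>(\<omega> in M. \<forall>i\<in>{1..t}. X u i \<omega> = y i u) * trans_prob r s (y t u) (y (Suc t) u))"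
        by (intro prod.cong refl) (rule two_state_markov_path_prob[OF \<open>prob_space M\<close> markov t])
      then show ?thesis
        unfolding independent_users_path_prob[OF \<open>prob_space M\<close> X U] using ext by (simp add: prod.distrib)
    qed
  qed
qed

text \<open>Matching the pattern \<open>w\<close> on \<open>U\<close> is the indicator of a single
  state of the joint chain, so the results for functions of the chain apply. The bound
  \<open>0 \<le> v\<close> later allows \<open>v\<close> to be written as a square.\<close>

lemma temporal_limits_match:
  fixes r s lam theta :: real and X :: "nat \<times> nat \<Rightarrow> nat \<Rightarrow> 'a \<Rightarrow> mode" and w :: "nat \<times> nat \<Rightarrow> mode"
  assumes "prob_space M" "r \<in> {0..1}" "s \<in> {0..1}" "0 < r + s" "r + s < 2"
    and "lam = r / (r + s)" "theta = 1 - r - s"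
    and "independent_two_state_users M C N r s X" "finite U" "U \<noteq> {}" "U \<subseteq> users C N"
  defines "S \<equiv> \<lambda>t \<omega>. of_bool (\<forall>u\<in>U. X u t \<omega> = w u)" and "m \<equiv> \<Prod>u\<in>U. stationary lam (w u)"
  shows "has_temporal_mean M S m"
    and "\<exists>v\<ge>0. has_temporal_variance M S m v \<and>
      (\<lambda>k. ((\<Prod>u\<in>U. trans_power lam theta (Suc k) (w u) (w u)) - m) * m) sums ((v - m + m\<^sup>2) / 2)"
proof -
  note * = assms(2-7)
  interpret chain: finite_markov_chain M "\<lambda>t \<omega>. \<lambda>u\<in>U. X u t \<omega>" "PiE U (\<lambda>_. UNIV)"
    "\<lambda>x y. \<Prod>u\<in>U. trans_prob r s (x u) (y u)" "\<lambda>x. \<Prod>u\<in>U. stationary lam (x u)"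
    by (rule product_markov_chain[OF assms(1-11)])
  \<comment> \<open>States of the joint chain are extensional on \<open>U\<close>, so the pattern
    has to be restricted before it can be one of them.\<close>
  define w' where "w' = restrict w U"
  have w': "w' \<in> PiE U (\<lambda>_. UNIV)"
    by (simp add: w'_def)
  have S: "S = (\<lambda>t \<omega>. of_bool ((\<lambda>u\<in>U. X u t \<omega>) = w'))"
    by (auto simp: S_def w'_def fun_eq_iff restrict_def)
  have prod_w': "(\<Prod>u\<in>U. F u (w' u)) = (\<Prod>u\<in>U. F u (w u))" for F :: "_ \<Rightarrow> _ \<Rightarrow> real"
    by (intro prod.cong) (auto simp: w'_def)
  have m: "chain.mean (\<lambda>x. of_bool (x = w')) = m"
    using w' chain.finite_states prod_w'[of "\<lambda>_. stationary lam"]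
    by (simp add: chain.mean_def of_bool_def m_def if_distrib cong: if_cong)
  show "has_temporal_mean M S m"
    using chain.has_temporal_mean_function[of "\<lambda>x. of_bool (x = w')"] by (simp only: S m)
  let ?v = "chain.asymptotic_variance (\<lambda>x. of_bool (x = w') - m)"
  have "has_temporal_variance M S m ?v"
    using chain.has_temporal_variance_function[of "\<lambda>x. of_bool (x = w')"] by (simp only: S m)
  moreover have "0 \<le> ?v"
    using chain.mean_centered[of "\<lambda>x. of_bool (x = w')"] by (intro chain.asymptotic_variance_nonneg) (simp only: m)
  moreover have "(\<lambda>k. ((\<Prod>u\<in>U. trans_power lam theta (Suc k) (w u) (w u)) - m) * m) sums ((?v - m + m\<^sup>2) / 2)"
    using chain.sums_asymptotic_variance_state[OF w'] prod_w'[of "\<lambda>_. stationary lam"]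
      prod_w'[of "\<lambda>_ z. trans_power lam theta (Suc _) z z"]
    by (simp only: kernel_step_power_prod[OF * \<open>finite U\<close> w' w'] m_def[symmetric])
  ultimately show "\<exists>v\<ge>0. has_temporal_variance M S m v \<and>
      (\<lambda>k. ((\<Prod>u\<in>U. trans_power lam theta (Suc k) (w u) (w u)) - m) * m) sums ((v - m + m\<^sup>2) / 2)"
    by blast
qed

text \<open>The strict bounds on \<open>r + s\<close> mean \<open>\<bar>theta\<bar> < 1\<close>.
  They exclude \<open>r = s = 0\<close>, where \<open>r / (r + s)\<close> is undefined in
  mathematics, and \<open>r = s = 1\<close>, where \<open>theta = -1\<close> and the terms of the
  variance series do not tend to zero.\<close>

theorem theorem1:
  fixes M :: "'a measure" and C N :: nat and r s lam theta :: real
    and X :: "nat \<times> nat \<Rightarrow> nat \<Rightarrow> 'a \<Rightarrow> mode"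
  assumes "prob_space M"
    and "C \<ge> 1" and "N \<ge> 2"
    and "r \<in> {0..1}" and "s \<in> {0..1}" and "0 < r + s" and "r + s < 2"
    and "independent_two_state_users M C N r s X"
    and "lam = r / (r + s)" and "theta = 1 - r - s"
  shows "\<exists>m_a v_a m_p v_p.
    (\<forall>u\<in>users C N.
       has_temporal_mean M (delivery N X u) m_a \<and>
       has_temporal_variance M (delivery N X u) m_a (v_a\<^sup>2)) \<and>
    has_temporal_mean M (passive_detection C N X) m_p \<and>
    has_temporal_variance M (passive_detection C N X) m_p (v_p\<^sup>2) \<and>
    m_a = lam * (1 - lam) ^ (N - 1) \<and>
    m_p = (1 - lam) ^ (C * N) \<and>
    summable (\<lambda>k. ((lam + (1 - lam) * theta ^ Suc k)
        * (1 - lam + lam * theta ^ Suc k) ^ (N - 1) - m_a) * m_a) \<and>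
    v_a\<^sup>2 = 2 * (\<Sum>k. ((lam + (1 - lam) * theta ^ Suc k)
        * (1 - lam + lam * theta ^ Suc k) ^ (N - 1) - m_a) * m_a) + m_a - m_a\<^sup>2 \<and>
    summable (\<lambda>k. ((1 - lam + lam * theta ^ Suc k) ^ (C * N) - m_p) * m_p) \<and>
    v_p\<^sup>2 = 2 * (\<Sum>k. ((1 - lam + lam * theta ^ Suc k) ^ (C * N) - m_p) * m_p)
        + m_p - m_p\<^sup>2"
proof -
  define m_a where "m_a = lam * (1 - lam) ^ (N - 1)"
  define m_p where "m_p = (1 - lam) ^ (C * N)"
  define A where "A k = ((lam + (1 - lam) * theta ^ Suc k) * (1 - lam + lam * theta ^ Suc k) ^ (N - 1) - m_a) * m_a" for k
  define D where "D k = ((1 - lam + lam * theta ^ Suc k) ^ (C * N) - m_p) * m_p" for k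
  note limits = temporal_limits_match[OF assms(1,4-7,9,10,8)]
  have "0 < N" "0 < C"
    using assms(2,3) by auto
  have Idle_iff: "z = Idle \<longleftrightarrow> z \<noteq> TX" for z
    by (cases z) auto
  have TX: "stationary lam TX = lam" "trans_power lam theta k TX TX = lam + (1 - lam) * theta ^ k"
    and Idle: "stationary lam Idle = 1 - lam" "trans_power lam theta k Idle Idle = 1 - lam + lam * theta ^ k" for k
    by (simp_all add: stationary_def trans_power_def mult.commute)
  have active: "has_temporal_mean M (delivery N X u) m_a \<and>
      (\<exists>v\<ge>0. has_temporal_variance M (delivery N X u) m_a v \<and> A sums ((v - m_a + m_a\<^sup>2) / 2))"
    if u: "u \<in> users C N" for u
  proof -
    obtain c i where ci: "u = (c, i)" "c < C" "i < N"
      using u by (auto simp: users_def)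
    define U where "U = {c} \<times> {..<N}"
    \<comment> \<open>Successful delivery by \<open>u\<close> is exactly this pattern on the cluster
      of \<open>u\<close>; it yields one TX factor and \<open>N - 1\<close> Idle factors.\<close>
    define w where "w = (\<lambda>x. if x = u then TX else Idle)"
    have U: "finite U" "U \<noteq> {}" "U \<subseteq> users C N" "u \<in> U" "card U = N"
      using ci \<open>0 < N\<close> by (auto simp: U_def users_def)
    have prod_w: "(\<Prod>x\<in>U. F (w x)) = F TX * F Idle ^ (N - 1)" for F :: "mode \<Rightarrow> real"
    proof -
      have "(\<Prod>x\<in>U. F (w x)) = F (w u) * (\<Prod>x\<in>U - {u}. F (w x))"
        using U by (intro prod.remove)
      also have "(\<Prod>x\<in>U - {u}. F (w x)) = (\<Prod>x\<in>U - {u}. F Idle)"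
        by (intro prod.cong) (auto simp: w_def)
      finally show ?thesis
        using U by (simp add: w_def)
    qed
    have "(\<lambda>t \<omega>. of_bool (\<forall>x\<in>U. X x t \<omega> = w x)) = delivery N X u"
      unfolding delivery_def ci(1) U_def w_def using ci(3) by (auto simp: fun_eq_iff Idle_iff)
    then show ?thesis
      using limits[OF U(1-3), of w]
      by (simp only: prod_w[of "stationary lam"] prod_w[of "\<lambda>z. trans_power lam theta _ z z"] TX Idle m_a_def[symmetric] A_def[abs_def])
  qed
  have "has_temporal_mean M (passive_detection C N X) m_p \<and>
      (\<exists>v\<ge>0. has_temporal_variance M (passive_detection C N X) m_p v \<and> D sums ((v - m_p + m_p\<^sup>2) / 2))"
  proof -
    have U: "finite (users C N)" "users C N \<noteq> {}" "users C N \<subseteq> users C N" "card (users C N) = C * N"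
      using \<open>0 < N\<close> \<open>0 < C\<close> by (auto simp: users_def card_cartesian_product)
    \<comment> \<open>The passive user detects silence exactly when the joint state of all users is
      the all-Idle pattern.\<close>
    have "(\<lambda>t \<omega>. of_bool (\<forall>x\<in>users C N. X x t \<omega> = Idle)) = passive_detection C N X"
      by (simp add: fun_eq_iff passive_detection_def Idle_iff)
    then show ?thesis
      using limits[OF U(1-3), of "\<lambda>_. Idle"]
      by (simp only: prod_constant U(4) Idle m_p_def[symmetric] D_def[abs_def])
  qed
  then obtain v_p where v_p: "has_temporal_mean M (passive_detection C N X) m_p" "0 \<le> v_p"
      "has_temporal_variance M (passive_detection C N X) m_p v_p" "D sums ((v_p - m_p + m_p\<^sup>2) / 2)"
    by blast
  have "(0, 0) \<in> users C N"
    using \<open>0 < N\<close> \<open>0 < C\<close> by (simp add: users_def)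
  then obtain v_a where v_a: "0 \<le> v_a" "A sums ((v_a - m_a + m_a\<^sup>2) / 2)"
    using active by blast
  have "has_temporal_mean M (delivery N X u) m_a \<and> has_temporal_variance M (delivery N X u) m_a ((sqrt v_a)\<^sup>2)"
    if u: "u \<in> users C N" for u
  proof -
    obtain v where v: "0 \<le> v" "has_temporal_variance M (delivery N X u) m_a v" "A sums ((v - m_a + m_a\<^sup>2) / 2)"
      using active[OF u] by blast
    \<comment> \<open>The series \<open>A\<close> is the same for every user and determines the
      variance, so the value chosen for user \<open>(0, 0)\<close> serves all of them.\<close>
    have "v = v_a"
      using sums_unique2[OF v(3) v_a(2)] by simp
    then show ?thesis
      using active[OF u] v by simp
  qed
  moreover have "summable A" "(sqrt v_a)\<^sup>2 = 2 * suminf A + m_a - m_a\<^sup>2"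
    using v_a sums_summable[OF v_a(2)] sums_unique[OF v_a(2)] by (simp_all add: field_simps)
  moreover have "summable D" "(sqrt v_p)\<^sup>2 = 2 * suminf D + m_p - m_p\<^sup>2"
    using v_p(2) sums_summable[OF v_p(4)] sums_unique[OF v_p(4)] by (simp_all add: field_simps)
  moreover have "has_temporal_variance M (passive_detection C N X) m_p ((sqrt v_p)\<^sup>2)"
    using v_p(2,3) by simp
  ultimately show ?thesis
    using v_p(1) unfolding A_def[abs_def] D_def[abs_def]
    by (intro exI[of _ m_a] exI[of _ "sqrt v_a"] exI[of _ m_p] exI[of _ "sqrt v_p"])
      (auto simp: m_a_def m_p_def)
qed

end
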